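(* Let $X,Y$ be compact metric spaces and let $T$ be a common functional capacity from $F_+(Y)$ to $F_+(X)$. Then: (1) The map $\tilde T$ defined for every $f\in C(Y)$ by $$\tilde Tf(x)=\sup\Big\{\int_Yf\,d\sigma:\ \sigma\in\mathcal{P}(Y),\ \sigma\le_{\mathcal{K}}T^x\Big\}$$ is a saturated positively $1$-homogenous backward Kantorovich operator such that $\tilde T\le_{\mathcal{K}}T$. (2) If $T$ is a positively $1$-homogenous Kantorovich operator, then $T\le\tilde T$ on $C_+(Y)$, and for any $g\in C(Y)$, $$\tilde Tg(x)=\sup\{Sg(x):\ S\ \text{is a positively $1$-homogenous Kantorovich operator with}\ \hat S\le\hat T\}.$$ (3) If $T$ is saturated, then $\tilde T\le T$. (4) If $T$ is a saturated positively $1$-homogenous Kantorovich operator, then $T=\tilde T$ on $C_+(Y)$. (5) $\tilde T$ is minimal among saturated positively $1$-homogenous Kantorovich operators greater than $T$. ($\tilde T$ is called the Dellacherie envelope of $T$.)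
   Context: $\mathcal{P}$: probability measures, weak$^*$ topology. $\chi_A$: indicator of $A$. $F_+(Y)$: functions $Y\to[0,+\infty]$. $C_+(Y)$: non-negative continuous functions. $USC(X)$: bounded above, proper (not identically $-\infty$), upper semi-continuous functions $X\to[-\infty,\infty)$; $USC_+$: its non-negative elements. Functional capacity: a map $T:F_+(Y)\to F_+(X)$ such that (i) $f\le g\Rightarrow Tf\le Tg$; (ii) $T$ maps $USC_+(Y)$ to $USC(X)$, and $g_n\downarrow g$ in $USC_+(Y)$ implies $Tg_n\downarrow Tg$; (iii) $g_n\uparrow g$ in $F_+(Y)$ implies $Tg_n\uparrow Tg$. Backward Kantorovich operator ("Kantorovich operator"): a map $S:C(Y)\to USC(X)$ that is monotone, satisfies $S(g+c)=Sg+c$ for $c\in\mathbb{R}$, is convex ($S(\lambda g_1+(1-\lambda)g_2)\le\lambda Sg_1+(1-\lambda)Sg_2$, $\lambda\in[0,1]$), and lower semi-continuous ($g_n\to g$ uniformly implies $\liminf_nSg_n\ge Sg$ pointwise). It is extended to upper semi-continuous $g$ by $Sg(x)=\inf\{Sh(x):h\in C(Y),h\ge g\}$. A functional capacity is called a Kantorovich operator if it coincides on non-negative upper semi-continuous functions with (the extension of) a backward Kantorovich operator. Positively $1$-homogenous: $T(\lambda g)=\lambda Tg$, $\lambda\ge0$. Write $T^x(f)=Tf(x)$ and $T^x(A)=T\chi_A(x)$. For $\sigma\in\mathcal{P}(Y)$, $\sigma\le_{\mathcal{K}}T^x$ means $\sigma(K)\le T^x(K)$ for every compact $K\subset Y$;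 $S\le_{\mathcal{K}}T$ means $S^x(K)\le T^x(K)$ for all $x\in X$ and compact $K\subset Y$. The Choquet extension is $\hat Tf(x)=\int_0^{+\infty}T^x(\{f\ge\alpha\})\,d\alpha$ for non-negative $f$; one has $\hat S\le\hat T$ on $USC_+(Y)$ if and only if $S\le_{\mathcal{K}}T$, and $\hat S\le\hat T$ is understood this way. $T$ is common if for each $x\in X$ there is $\nu\in\mathcal{P}(Y)$ with $\nu\le_{\mathcal{K}}T^x$. $T$ is saturated if for each $x\in X$ and any $\sigma\in\mathcal{P}(Y)$: $\sigma\le_{\mathcal{K}}T^x$ if and only if $\int_Yf\,d\sigma\le T^x(f)$ for all $f\in USC_+(Y)$. The order relations in (3) and (5) are understood on $USC_+(Y)$.
   Formalization: In (5), T̃ ≤ S is proved for every saturated positively 1-homogenous Kantorovich S ≥ T, but T ≤ T̃ (T̃ itself in the class) only when T is a positively 1-homogenous Kantorovich operator; it fails for general T (one-point spaces, Tf = 2f). *)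

theory Defs
  imports "HOL-Probability.Probability"
begin

section \<open>Function classes\<close>

text \<open>
  \<open>F\<^sub>+(Y)\<close> is the type \<^typ>\<open>'y \<Rightarrow> ennreal\<close>, and \<open>[-\<infinity>,\<infinity>)\<close>-valued functions live in
  \<^typ>\<open>'x \<Rightarrow> ereal\<close>.  Maps defined on \<open>C(Y)\<close> are total functions on \<^typ>\<open>'y \<Rightarrow> real\<close> whose
  values outside \<open>C(Y)\<close> are never used.
\<close>

definition upper_semicontinuous :: "('a::topological_space \<Rightarrow> ereal) \<Rightarrow> bool" where
  "upper_semicontinuous f \<longleftrightarrow> (\<forall>c. open {x. f x < c})"

definition USC :: "('a::topological_space \<Rightarrow> ereal) set" where
  "USC = {f. upper_semicontinuous f \<and> (\<exists>M::real. \<forall>x. f x \<le> ereal M) \<and> (\<exists>x. f x \<noteq> -\<infinity>)}"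

definition USC_plus :: "('a::topological_space \<Rightarrow> ennreal) set" where
  "USC_plus = {f. (\<lambda>x. enn2ereal (f x)) \<in> USC}"

definition Cont :: "('a::topological_space \<Rightarrow> real) set" where
  "Cont = {g. continuous_on UNIV g}"

definition Cont_plus :: "('a::topological_space \<Rightarrow> real) set" where
  "Cont_plus = {g \<in> Cont. \<forall>y. 0 \<le> g y}"

section \<open>Functional capacities and Kantorovich operators\<close>

text \<open>
  In the second clause the limit \<open>INF n. g n\<close> of a decreasing sequence in \<^const>\<open>USC_plus\<close> is
  again in \<^const>\<open>USC_plus\<close>; that \<open>T (g n)\<close> is itself monotone in \<open>n\<close> follows from \<open>mono T\<close>.
\<close>

definition functional_capacity ::
    "(('y::topological_space \<Rightarrow> ennreal) \<Rightarrow> 'x::topological_space \<Rightarrow> ennreal) \<Rightarrow> bool" where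
  "functional_capacity T \<longleftrightarrow>
     mono T \<and>
     (\<forall>g\<in>USC_plus. (\<lambda>x. enn2ereal (T g x)) \<in> USC) \<and>
     (\<forall>g::nat \<Rightarrow> 'y \<Rightarrow> ennreal. (\<forall>n. g n \<in> USC_plus) \<and> decseq g \<longrightarrow>
        T (\<lambda>y. INF n. g n y) = (\<lambda>x. INF n. T (g n) x)) \<and>
     (\<forall>g::nat \<Rightarrow> 'y \<Rightarrow> ennreal. incseq g \<longrightarrow>
        T (\<lambda>y. SUP n. g n y) = (\<lambda>x. SUP n. T (g n) x))"

definition backward_Kantorovich ::
    "(('y::topological_space \<Rightarrow> real) \<Rightarrow> 'x::topological_space \<Rightarrow> ereal) \<Rightarrow> bool" where
  "backward_Kantorovich S \<longleftrightarrow>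
     (\<forall>g\<in>Cont. S g \<in> USC) \<and>
     (\<forall>g\<in>Cont. \<forall>h\<in>Cont. g \<le> h \<longrightarrow> S g \<le> S h) \<and>
     (\<forall>g\<in>Cont. \<forall>c::real. \<forall>x. S (\<lambda>y. g y + c) x = S g x + ereal c) \<and>
     (\<forall>g\<in>Cont. \<forall>h\<in>Cont. \<forall>t\<in>{0..1}. \<forall>x.
        S (\<lambda>y. t * g y + (1 - t) * h y) x \<le> ereal t * S g x + ereal (1 - t) * S h x) \<and>
     (\<forall>(g::nat \<Rightarrow> 'y \<Rightarrow> real) h. (\<forall>n. g n \<in> Cont) \<and> h \<in> Cont \<and>
        uniform_limit UNIV g h sequentially \<longrightarrow> (\<forall>x. S h x \<le> liminf (\<lambda>n. S (g n) x)))"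

definition usc_ext ::
    "(('y::topological_space \<Rightarrow> real) \<Rightarrow> 'x \<Rightarrow> ereal) \<Rightarrow> ('y \<Rightarrow> ereal) \<Rightarrow> 'x \<Rightarrow> ereal" where
  "usc_ext S g x = (INF h\<in>{h\<in>Cont. \<forall>y. g y \<le> ereal (h y)}. S h x)"

text \<open>
  Capacities and (extended) backward Kantorovich operators both act on \<^const>\<open>USC_plus\<close>.  The
  next two constants put them on the common type \<^typ>\<open>('y \<Rightarrow> ennreal) \<Rightarrow> 'x \<Rightarrow> ereal\<close>, on
  which domination, saturation and the Choquet extension are defined once for both.
\<close>

definition cap_fun :: "(('y \<Rightarrow> ennreal) \<Rightarrow> 'x \<Rightarrow> ennreal) \<Rightarrow> ('y \<Rightarrow> ennreal) \<Rightarrow> 'x \<Rightarrow> ereal" where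
  "cap_fun T f x = enn2ereal (T f x)"

definition kant_fun ::
    "(('y::topological_space \<Rightarrow> real) \<Rightarrow> 'x \<Rightarrow> ereal) \<Rightarrow> ('y \<Rightarrow> ennreal) \<Rightarrow> 'x \<Rightarrow> ereal" where
  "kant_fun S f x = usc_ext S (\<lambda>y. enn2ereal (f y)) x"

definition Kantorovich_capacity ::
    "(('y::topological_space \<Rightarrow> ennreal) \<Rightarrow> 'x::topological_space \<Rightarrow> ennreal) \<Rightarrow> bool" where
  "Kantorovich_capacity T \<longleftrightarrow> functional_capacity T \<and>
     (\<exists>S. backward_Kantorovich S \<and> (\<forall>f\<in>USC_plus. \<forall>x. cap_fun T f x = kant_fun S f x))"

definition pos_homogenous_cap :: "(('y \<Rightarrow> ennreal) \<Rightarrow> 'x \<Rightarrow> ennreal) \<Rightarrow> bool" where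
  "pos_homogenous_cap T \<longleftrightarrow>
     (\<forall>g. \<forall>t\<ge>0::real. \<forall>x. T (\<lambda>y. ennreal t * g y) x = ennreal t * T g x)"

definition pos_homogenous_kant ::
    "(('y::topological_space \<Rightarrow> real) \<Rightarrow> 'x \<Rightarrow> ereal) \<Rightarrow> bool" where
  "pos_homogenous_kant S \<longleftrightarrow>
     (\<forall>g\<in>Cont. \<forall>t\<ge>0::real. \<forall>x. S (\<lambda>y. t * g y) x = ereal t * S g x)"

section \<open>Domination on compact sets, saturation, Choquet extension\<close>

definition prob_measures :: "'y::topological_space measure set" where
  "prob_measures = {\<sigma>. prob_space \<sigma> \<and> sets \<sigma> = sets borel}"

definition dominated_at ::
    "'y::topological_space measure \<Rightarrow> (('y \<Rightarrow> ennreal) \<Rightarrow> 'x \<Rightarrow> ereal) \<Rightarrow> 'x \<Rightarrow> bool" where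
  "dominated_at \<sigma> \<Phi> x \<longleftrightarrow>
     (\<forall>K. compact K \<longrightarrow> enn2ereal (emeasure \<sigma> K) \<le> \<Phi> (indicator K) x)"

definition le_compact ::
    "(('y::topological_space \<Rightarrow> ennreal) \<Rightarrow> 'x \<Rightarrow> ereal) \<Rightarrow> (('y \<Rightarrow> ennreal) \<Rightarrow> 'x \<Rightarrow> ereal) \<Rightarrow> bool" where
  "le_compact \<Phi> \<Psi> \<longleftrightarrow> (\<forall>x. \<forall>K. compact K \<longrightarrow> \<Phi> (indicator K) x \<le> \<Psi> (indicator K) x)"

definition le_USC_plus ::
    "(('y::topological_space \<Rightarrow> ennreal) \<Rightarrow> 'x \<Rightarrow> ereal) \<Rightarrow> (('y \<Rightarrow> ennreal) \<Rightarrow> 'x \<Rightarrow> ereal) \<Rightarrow> bool" where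
  "le_USC_plus \<Phi> \<Psi> \<longleftrightarrow> (\<forall>f\<in>USC_plus. \<forall>x. \<Phi> f x \<le> \<Psi> f x)"

definition common :: "(('y::topological_space \<Rightarrow> ennreal) \<Rightarrow> 'x \<Rightarrow> ereal) \<Rightarrow> bool" where
  "common \<Phi> \<longleftrightarrow> (\<forall>x. \<exists>\<nu>\<in>prob_measures. dominated_at \<nu> \<Phi> x)"

definition saturated :: "(('y::topological_space \<Rightarrow> ennreal) \<Rightarrow> 'x \<Rightarrow> ereal) \<Rightarrow> bool" where
  "saturated \<Phi> \<longleftrightarrow> (\<forall>x. \<forall>\<sigma>\<in>prob_measures.
     dominated_at \<sigma> \<Phi> x \<longleftrightarrow> (\<forall>f\<in>USC_plus. enn2ereal (\<integral>\<^sup>+y. f y \<partial>\<sigma>) \<le> \<Phi> f x))"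

text \<open>
  The truncation \<^const>\<open>e2ennreal\<close> is harmless for the operators considered: a monotone \<open>\<Phi>\<close> with
  \<open>\<Phi> 0 \<ge> 0\<close> is non-negative on indicators.
\<close>

definition choquet :: "(('y \<Rightarrow> ennreal) \<Rightarrow> 'x \<Rightarrow> ereal) \<Rightarrow> ('y \<Rightarrow> ennreal) \<Rightarrow> 'x \<Rightarrow> ereal" where
  "choquet \<Phi> f x =
     enn2ereal (\<integral>\<^sup>+\<alpha>\<in>{0..}. e2ennreal (\<Phi> (indicator {y. ennreal \<alpha> \<le> f y}) x) \<partial>lborel)"

section \<open>The Dellacherie envelope\<close>

definition dellacherie ::
    "(('y::topological_space \<Rightarrow> ennreal) \<Rightarrow> 'x \<Rightarrow> ennreal) \<Rightarrow> ('y \<Rightarrow> real) \<Rightarrow> 'x \<Rightarrow> ereal" where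
  "dellacherie T f x =
     (SUP \<sigma>\<in>{\<sigma>\<in>prob_measures. dominated_at \<sigma> (cap_fun T) x}. ereal (\<integral>y. f y \<partial>\<sigma>))"

end

theory Submission
  imports Defs
begin

text \<open>
  A monotone sublinear functional \<open>p\<close> on \<open>C(Y)\<close> fixing constants is attained at each \<open>f\<close> by a
  probability measure \<open>\<sigma>\<close> with \<open>\<integral> h d\<sigma> \<le> p h\<close> for all \<open>h\<close> (Hahn--Banach and Riesz).  If moreover
  \<open>inf {p h | h \<ge> \<chi>\<^sub>K}\<close> is at most \<open>T\<^sup>x(K)\<close> for all compact \<open>K\<close>, then \<open>\<sigma>\<close> is dominated by \<open>T\<^sup>x\<close>, so
  \<open>p f\<close> is at most the envelope of \<open>T\<close> at \<open>(f, x)\<close>.  With \<open>p = S\<^sup>x\<close> this bounds positively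
  homogeneous Kantorovich operators by the envelope; with \<open>p\<close> the upper semicontinuous hull of the
  envelope at \<open>x\<close> it gives upper semicontinuity without weak compactness of sets of measures.
\<close>

section \<open>The Hahn--Banach theorem for sublinear functionals\<close>

text \<open>The obstacle is that domination by \<open>T\<close> speaks of compact sets, whereas
  Hahn-Banach and Riesz give inequalities on C(Y). Continuity of \<open>T\<close> along decreasing
  sequences closes the gap: a compact K is the intersection of decreasing compact sets C_n, with
  continuous functions squeezed between the indicators of K and C_n, and T(C_n) decreases to T(K).
  Estimates through such functions lose nothing in the limit. For the upper semicontinuous hull the
  same squeeze works because x -> T^x(C) is itself upper semicontinuous. In the other direction,
  every measure dominated by \<open>T\<close> takes part in the supremum by definition. This makes
  saturation of the envelope almost tautological and reduces the upper bounds for the envelope in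
  (3)-(5) to saturation of the larger operator. The Choquet order in (2) is translated back to
  compact sets by evaluating it on their indicators.\<close>

definition sublinear :: "('a::real_vector \<Rightarrow> real) \<Rightarrow> bool" where
  "sublinear p \<longleftrightarrow> (\<forall>x y. p (x + y) \<le> p x + p y) \<and> (\<forall>t\<ge>0. \<forall>x. p (t *\<^sub>R x) = t * p x)"

lemma sublinear_add: "sublinear p \<Longrightarrow> p (x + y) \<le> p x + p y"
  and sublinear_scaleR: "sublinear p \<Longrightarrow> 0 \<le> t \<Longrightarrow> p (t *\<^sub>R x) = t * p x"
  by (auto simp: sublinear_def)

lemma sublinear_zero: "sublinear p \<Longrightarrow> p 0 = 0"
  using sublinear_scaleR[of p 0 0] by simp

lemma sublinear_minus_le: "sublinear p \<Longrightarrow> - p (- x) \<le> p x"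
  using sublinear_add[of p x "- x"] sublinear_zero[of p] by simp

text \<open>One inequality is enough: used with 1/t at the point t x, it returns the reverse
  one.\<close>

lemma sublinearI:
  assumes add: "\<And>x y. p (x + y) \<le> p x + p y" and zero: "p 0 = 0"
    and scale: "\<And>t x. 0 < t \<Longrightarrow> p (t *\<^sub>R x) \<le> t * p x"
  shows "sublinear p"
  unfolding sublinear_def
proof (intro conjI allI impI)
  fix t :: real and x assume "0 \<le> t"
  show "p (t *\<^sub>R x) = t * p x"
  proof (cases "t = 0")
    case False
    with \<open>0 \<le> t\<close> have t: "0 < t" by simp
    have "p ((1 / t) *\<^sub>R (t *\<^sub>R x)) \<le> (1 / t) * p (t *\<^sub>R x)"
      by (rule scale) (use t in simp)
    then have "t * p x \<le> p (t *\<^sub>R x)"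
      using t by (simp add: field_simps)
    with scale[OF t, of x] show ?thesis by simp
  qed (simp add: zero)
qed (rule add)

text \<open>The witness is the largest sublinear functional below \<open>p\<close> with value at
  most \<open>- p a\<close> at \<open>- a\<close>: any such r satisfies r(x) \<le> r(x + t a) + t
  r(- a) \<le> p(x + t a) - t p(a). Taking t = 0 gives \<open>q \<le> p\<close>, and t = 1 gives the
  bound at \<open>- a\<close>.\<close>

lemma sublinear_tilt:
  assumes p: "sublinear p"
  obtains q where "sublinear q" "q \<le> p" "q (- a) \<le> - p a"
proof -
  define q where "q x = (INF t\<in>{0..}. p (x + t *\<^sub>R a) - t * p a)" for x
  have low: "- p (- x) \<le> p (x + t *\<^sub>R a) - t * p a" if "0 \<le> t" for x t
    using sublinear_add[OF p, of "x + t *\<^sub>R a" "- x"] sublinear_scaleR[OF p that, of a] by simp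
  have bdd: "bdd_below ((\<lambda>t. p (x + t *\<^sub>R a) - t * p a) ` {0..})" for x
    by (rule bdd_belowI2[of _ "- p (- x)"]) (use low in auto)
  have le: "q x \<le> p (x + t *\<^sub>R a) - t * p a" if "0 \<le> t" for x t
    unfolding q_def by (rule cINF_lower[OF bdd]) (use that in simp)
  have ge: "c \<le> q x" if "\<And>t. 0 \<le> t \<Longrightarrow> c \<le> p (x + t *\<^sub>R a) - t * p a" for c x
    unfolding q_def by (rule cINF_greatest) (use that in auto)
  have "sublinear q"
  proof (rule sublinearI)
    fix x y
    have "q (x + y) - (p (x + s *\<^sub>R a) - s * p a) \<le> q y" if s: "0 \<le> s" for s
    proof (rule ge)
      fix t :: real assume t: "0 \<le> t"
      have "q (x + y) \<le> p ((x + y) + (s + t) *\<^sub>R a) - (s + t) * p a"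
        by (rule le) (use s t in simp)
      also have "(x + y) + (s + t) *\<^sub>R a = (x + s *\<^sub>R a) + (y + t *\<^sub>R a)"
        by (simp add: algebra_simps)
      finally show "q (x + y) - (p (x + s *\<^sub>R a) - s * p a) \<le> p (y + t *\<^sub>R a) - t * p a"
        using sublinear_add[OF p, of "x + s *\<^sub>R a" "y + t *\<^sub>R a"] by (simp add: algebra_simps)
    qed
    then have "q (x + y) - q y \<le> q x"
      by (intro ge) (simp add: algebra_simps)
    then show "q (x + y) \<le> q x + q y" by simp
  next
    have "0 \<le> q 0"
      by (rule ge) (simp add: sublinear_scaleR[OF p])
    moreover have "q 0 \<le> 0"
      using le[of 0 0] by (simp add: sublinear_zero[OF p])
    ultimately show "q 0 = 0" by simp
  next
    fix s :: real and x assume s: "0 < s"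
    have "(1 / s) * q (s *\<^sub>R x) \<le> q x"
    proof (rule ge)
      fix t :: real assume t: "0 \<le> t"
      have "q (s *\<^sub>R x) \<le> p (s *\<^sub>R x + (s * t) *\<^sub>R a) - (s * t) * p a"
        by (rule le) (use s t in simp)
      also have "s *\<^sub>R x + (s * t) *\<^sub>R a = s *\<^sub>R (x + t *\<^sub>R a)"
        by (simp add: algebra_simps)
      also have "p \<dots> = s * p (x + t *\<^sub>R a)"
        by (rule sublinear_scaleR[OF p]) (use s in simp)
      finally have "q (s *\<^sub>R x) \<le> s * (p (x + t *\<^sub>R a) - t * p a)"
        by (simp add: algebra_simps)
      then show "(1 / s) * q (s *\<^sub>R x) \<le> p (x + t *\<^sub>R a) - t * p a"
        using s by (simp add: field_simps)
    qed
    then show "q (s *\<^sub>R x) \<le> s * q x"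
      using s by (simp add: field_simps)
  qed
  moreover have "q \<le> p"
    using le[of 0] by (simp add: le_fun_def)
  moreover have "q (- a) \<le> - p a"
    using le[of 1 "- a"] sublinear_zero[OF p] by simp
  ultimately show thesis by (rule that)
qed

text \<open>An infimum of sublinear functionals need not be subadditive. On a chain it is, because
  of two members the smaller one serves for both summands.\<close>

lemma sublinear_chain_Inf:
  assumes sub: "\<And>q. q \<in> C \<Longrightarrow> sublinear q \<and> q \<le> p" and "C \<noteq> {}"
    and chain: "\<And>q r. q \<in> C \<Longrightarrow> r \<in> C \<Longrightarrow> q \<le> r \<or> r \<le> q"
  obtains u where "sublinear u" "\<And>q. q \<in> C \<Longrightarrow> u \<le> q"
proof -
  define u where "u x = (INF q\<in>C. q x)" for x
  have bdd: "bdd_below ((\<lambda>q. q x) ` C)" for x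
  proof (rule bdd_belowI2[of _ "- p (- x)"])
    fix q assume "q \<in> C"
    with sub have "sublinear q" "q (- x) \<le> p (- x)" by (auto simp: le_fun_def)
    with sublinear_minus_le[of q x] show "- p (- x) \<le> q x" by simp
  qed
  have le: "u x \<le> q x" if "q \<in> C" for q x
    unfolding u_def by (rule cINF_lower[OF bdd that])
  have ge: "c \<le> u x" if "\<And>q. q \<in> C \<Longrightarrow> c \<le> q x" for c x
    unfolding u_def using \<open>C \<noteq> {}\<close> that by (rule cINF_greatest)
  have "sublinear u"
  proof (rule sublinearI)
    fix x y
    have "u (x + y) - q x \<le> r y" if q: "q \<in> C" and r: "r \<in> C" for q r
    proof (cases "q \<le> r")
      case True
      then have "q y \<le> r y" by (simp add: le_fun_def)
      with le[OF q, of "x + y"] sublinear_add[of q x y] sub[OF q] show ?thesis by simp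
    next
      case False
      then have "r x \<le> q x" using chain[OF q r] by (auto simp: le_fun_def)
      with le[OF r, of "x + y"] sublinear_add[of r x y] sub[OF r] show ?thesis by simp
    qed
    then have "u (x + y) - q x \<le> u y" if "q \<in> C" for q
      using that by (intro ge)
    then have "u (x + y) - u y \<le> u x"
      by (intro ge) (simp add: algebra_simps)
    then show "u (x + y) \<le> u x + u y" by simp
  next
    have zero: "q 0 = 0" if "q \<in> C" for q
      using sub[OF that] by (simp add: sublinear_zero)
    obtain q where "q \<in> C" using \<open>C \<noteq> {}\<close> by auto
    then have "u 0 \<le> 0" using le[of q 0] zero[of q] by simp
    moreover have "0 \<le> u 0" by (rule ge) (simp add: zero)
    ultimately show "u 0 = 0" by simp
  next
    fix s :: real and x assume s: "0 < s"
    have "(1 / s) * u (s *\<^sub>R x) \<le> u x"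
    proof (rule ge)
      fix q assume q: "q \<in> C"
      have "u (s *\<^sub>R x) \<le> s * q x"
        using le[OF q, of "s *\<^sub>R x"] sub[OF q] s by (simp add: sublinear_scaleR)
      then show "(1 / s) * u (s *\<^sub>R x) \<le> q x"
        using s by (simp add: field_simps)
    qed
    then show "u (s *\<^sub>R x) \<le> s * u x"
      using s by (simp add: field_simps)
  qed
  then show thesis using le by (intro that) (auto simp: le_fun_def)
qed

text \<open>A minimal sublinear functional is linear, because tilting it in any direction
  does not change it.\<close>

lemma sublinear_dominates_linear:
  assumes p: "sublinear p"
  obtains l where "linear l" "l \<le> p"
proof -
  define A where "A = {q. sublinear q \<and> q \<le> p}"
  \<comment> \<open>The order is reversed, so that Zorn's lemma yields a minimal functional.\<close>
  define P :: "('a \<Rightarrow> real) \<Rightarrow> ('a \<Rightarrow> real) \<Rightarrow> bool" where "P q r \<longleftrightarrow> r \<le> q" for q r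
  have "\<exists>m\<in>A. \<forall>a\<in>A. P m a \<longrightarrow> a = m"
  proof (rule predicate_Zorn)
    show "partial_order_on A (relation_of P A)"
      by (rule partial_order_on_relation_ofI) (auto simp: P_def)
    fix C assume C: "C \<in> Chains (relation_of P A)"
    show "\<exists>u\<in>A. \<forall>a\<in>C. P a u"
    proof (cases "C = {}")
      case True
      then show ?thesis using p by (auto simp: A_def)
    next
      case False
      from C have CA: "q \<in> A" if "q \<in> C" for q
        using that by (auto simp: Chains_def relation_of_def)
      from C have chain: "q \<le> r \<or> r \<le> q" if "q \<in> C" "r \<in> C" for q r
        using that by (auto simp: Chains_def relation_of_def P_def)
      obtain u where u: "sublinear u" "\<And>q. q \<in> C \<Longrightarrow> u \<le> q"
        using sublinear_chain_Inf[of C p] CA chain False by (auto simp: A_def)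
      moreover from False obtain q where "q \<in> C" by auto
      ultimately have "u \<in> A"
        using CA order_trans[of u q p] by (auto simp: A_def)
      then show ?thesis using u(2) by (auto simp: P_def)
    qed
  qed
  then obtain l where "l \<in> A" and min: "\<And>q. q \<in> A \<Longrightarrow> q \<le> l \<Longrightarrow> q = l"
    by (auto simp: P_def)
  then have l: "sublinear l" "l \<le> p" by (auto simp: A_def)
  have neg: "l (- x) = - l x" for x
  proof (rule antisym)
    obtain q where "sublinear q" "q \<le> l" "q (- x) \<le> - l x"
      using sublinear_tilt[OF l(1)] .
    moreover from this have "q = l"
      using l(2) by (intro min) (auto simp: A_def)
    ultimately show "l (- x) \<le> - l x" by simp
    show "- l x \<le> l (- x)"
      using sublinear_minus_le[OF l(1), of "- x"] by simp
  qed
  have "linear l"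
  proof (rule linearI)
    fix x y
    have "l (- (x + y)) \<le> l (- x) + l (- y)"
      using sublinear_add[OF l(1), of "- x" "- y"] by simp
    then show "l (x + y) = l x + l y"
      using sublinear_add[OF l(1), of x y] unfolding neg by simp
  next
    fix t :: real and x
    show "l (t *\<^sub>R x) = t *\<^sub>R l x"
    proof (cases "0 \<le> t")
      case True
      then show ?thesis using sublinear_scaleR[OF l(1)] by simp
    next
      case False
      then have "l ((- t) *\<^sub>R x) = - t * l x"
        by (intro sublinear_scaleR[OF l(1)]) simp
      then show ?thesis using neg[of "t *\<^sub>R x"] by simp
    qed
  qed
  then show thesis using l(2) by (rule that)
qed

text \<open>After tilting, every linear \<open>l\<close> below \<open>q\<close> satisfies l(- a)
  \<le> - p(a), that is l(a) \<ge> p(a), so domination becomes equality at \<open>a\<close>.\<close>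

lemma sublinear_supporting_linear:
  assumes "sublinear p"
  obtains l where "linear l" "l \<le> p" "l a = p a"
proof -
  obtain q where q: "sublinear q" "q \<le> p" "q (- a) \<le> - p a"
    using sublinear_tilt[OF assms] .
  obtain l where l: "linear l" "l \<le> q"
    using sublinear_dominates_linear[OF q(1)] .
  have "l (- a) \<le> - p a" "l \<le> p"
    using l(2) q(2,3) by (auto simp: le_fun_def intro: order_trans)
  then have "l a = p a"
    using linear_neg[OF l(1), of a] by (auto simp: le_fun_def intro: antisym)
  with l(1) \<open>l \<le> p\<close> show thesis by (rule that)
qed

section \<open>The Riesz representation theorem on a compact metric space\<close>

lemma Cont_iff: "g \<in> Cont \<longleftrightarrow> continuous_on UNIV g"
  by (simp add: Cont_def)

lemma Cont_plus_iff: "g \<in> Cont_plus \<longleftrightarrow> continuous_on UNIV g \<and> (\<forall>y. 0 \<le> g y)"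
  by (simp add: Cont_plus_def Cont_def)

lemma Cont_bounded:
  assumes "compact (UNIV :: 'y::topological_space set)" and "g \<in> (Cont :: ('y \<Rightarrow> real) set)"
  obtains M where "0 < M" "\<And>y. \<bar>g y\<bar> \<le> M"
proof -
  have "bounded (range g)"
    using assms compact_continuous_image[of UNIV g] by (auto simp: Cont_iff compact_imp_bounded)
  then obtain M where "0 < M" "\<forall>z\<in>range g. norm z \<le> M"
    by (auto simp: bounded_pos)
  then show thesis by (intro that) auto
qed

lemma borel_measurable_Cont:
  assumes "sets \<sigma> = sets borel" and "g \<in> Cont"
  shows "g \<in> borel_measurable \<sigma>"
  using assms borel_measurable_continuous_onI[of g]
  by (simp add: Cont_iff measurable_cong_sets[OF assms(1) refl])

lemma integrable_Cont:
  assumes "compact (UNIV :: 'y::topological_space set)" and "\<sigma> \<in> (prob_measures :: 'y measure set)"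
    and "g \<in> Cont"
  shows "integrable \<sigma> g"
proof -
  interpret prob_space \<sigma> using assms(2) by (simp add: prob_measures_def)
  obtain M where "\<And>y. \<bar>g y\<bar> \<le> M" using Cont_bounded[OF assms(1,3)] by metis
  then show ?thesis
    using assms(2,3) by (intro integrable_const_bound[of _ M]) (auto simp: prob_measures_def borel_measurable_Cont)
qed

text \<open>Slice i is the part of [0, t] between i and i + 1. This is the discrete layer-cake
  formula behind \<open>riesz_measure_ge_unit\<close>.\<close>

lemma sum_clamp:
  fixes t :: real
  assumes "0 \<le> t"
  shows "(\<Sum>i<n. min 1 (max 0 (t - real i))) = min (real n) t"
proof (induction n)
  case (Suc n)
  then show ?case
    using assms by (cases "t \<le> real n"; cases "t \<le> real n + 1") simp_all
qed (use assms in simp)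

locale positive_functional =
  fixes L :: "('y::metric_space \<Rightarrow> real) \<Rightarrow> real"
  assumes compact_space: "compact (UNIV :: 'y set)"
    and add: "g \<in> Cont \<Longrightarrow> h \<in> Cont \<Longrightarrow> L (\<lambda>y. g y + h y) = L g + L h"
    and scale: "g \<in> Cont \<Longrightarrow> L (\<lambda>y. c * g y) = c * L g"
    and nonneg: "g \<in> Cont_plus \<Longrightarrow> 0 \<le> L g"
    and one: "L (\<lambda>_. 1) = 1"
begin

lemma const: "L (\<lambda>_. c) = c"
  using scale[of "\<lambda>_. 1" c] by (simp add: one Cont_iff)

lemma minus: "g \<in> Cont \<Longrightarrow> L (\<lambda>y. - g y) = - L g"
  using scale[of g "-1"] by simp

lemma diff:
  assumes "g \<in> Cont" "h \<in> Cont"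
  shows "L (\<lambda>y. g y - h y) = L g - L h"
proof -
  have "(\<lambda>y. - h y) \<in> Cont" using assms by (auto simp: Cont_iff intro: continuous_intros)
  then show ?thesis using add[of g "\<lambda>y. - h y"] minus[of h] assms by simp
qed

lemma mono:
  assumes "g \<in> Cont" "h \<in> Cont" "\<And>y. g y \<le> h y"
  shows "L g \<le> L h"
proof -
  have "(\<lambda>y. h y - g y) \<in> Cont_plus"
    using assms by (auto simp: Cont_plus_iff Cont_iff intro: continuous_intros)
  then show ?thesis using nonneg diff[OF assms(2,1)] by fastforce
qed

lemma sum:
  fixes n :: nat
  assumes "\<And>i. i < n \<Longrightarrow> g i \<in> Cont"
  shows "L (\<lambda>y. \<Sum>i<n. g i y) = (\<Sum>i<n. L (g i))"
  using assms
proof (induction n)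
  case 0
  then show ?case by (simp add: const)
next
  case (Suc n)
  have "(\<lambda>y. \<Sum>i<n. g i y) \<in> Cont"
    using Suc.prems by (auto simp: Cont_iff intro!: continuous_intros)
  then show ?case using Suc by (simp add: add)
qed

section \<open>The outer measure of a positive functional\<close>

definition cover :: "'y set \<Rightarrow> (nat \<Rightarrow> 'y \<Rightarrow> real) \<Rightarrow> bool" where
  "cover A g \<longleftrightarrow> (\<forall>n. g n \<in> Cont_plus) \<and> (\<forall>y. incseq (\<lambda>n. g n y)) \<and> (\<forall>y\<in>A. \<exists>n. 1 \<le> g n y)"

text \<open>This is the Daniell upper integral of the indicator of \<open>A\<close>. Increasing
  sequences of continuous functions stand in for lower semicontinuous majorants, so that all subsets
  are treated at once, without a detour over a content on open sets.\<close>

definition outer :: "'y set \<Rightarrow> ennreal" where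
  "outer A = (INF g\<in>{g. cover A g}. SUP n. ennreal (L (g n)))"

lemma coverD:
  assumes "cover A g"
  shows "g n \<in> Cont" "continuous_on UNIV (g n)" "0 \<le> g n y" "m \<le> n \<Longrightarrow> g m y \<le> g n y"
  using assms by (auto simp: cover_def Cont_plus_iff Cont_iff incseq_def)

lemma outer_le: "cover A g \<Longrightarrow> (\<And>n. ennreal (L (g n)) \<le> c) \<Longrightarrow> outer A \<le> c"
  unfolding outer_def by (rule INF_lower2[of g]) (auto intro: SUP_least)

text \<open>Dini's argument: compactness turns the pointwise covering into a uniform one.\<close>

lemma cover_ge:
  assumes g: "cover U g" and h: "h \<in> Cont" "\<And>y. h y \<le> 1" "\<And>y. y \<notin> U \<Longrightarrow> h y \<le> 0"
  shows "ennreal (L h) \<le> (SUP n. ennreal (L (g n)))"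
proof (rule ennreal_le_epsilon)
  fix e :: real assume e: "0 < e"
  define W where "W n = {y. h y < g n y + e}" for n
  have "open (W n)" for n
    unfolding W_def using h(1) coverD(2)[OF g]
    by (intro open_Collect_less continuous_intros) (auto simp: Cont_iff)
  moreover have "UNIV \<subseteq> (\<Union>n. W n)"
  proof
    fix y
    show "y \<in> (\<Union>n. W n)"
    proof (cases "y \<in> U")
      case True
      then obtain n where "1 \<le> g n y" using g by (auto simp: cover_def)
      then have "y \<in> W n" using h(2)[of y] e by (simp add: W_def)
      then show ?thesis by blast
    next
      case False
      then have "y \<in> W 0" using h(3)[of y] e coverD(3)[OF g, of 0 y] by (simp add: W_def)
      then show ?thesis by blast
    qed
  qed
  ultimately obtain D where D: "finite D" "UNIV \<subseteq> (\<Union>n\<in>D. W n)"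
    by (rule compactE_image[OF compact_space])
  define n where "n = Max D"
  have "h y \<le> g n y + e" for y
  proof -
    obtain m where m: "m \<in> D" "y \<in> W m" using D(2) by blast
    then have "m \<le> n" using D(1) by (simp add: n_def)
    then show ?thesis using coverD(4)[OF g, of m n y] m(2) by (simp add: W_def)
  qed
  then have "L h \<le> L (\<lambda>y. g n y + e)"
    using h(1) coverD(2)[OF g] by (intro mono) (auto simp: Cont_iff intro!: continuous_intros)
  also have "\<dots> = L (g n) + e"
    using add[of "g n" "\<lambda>_. e"] coverD(1)[OF g] by (simp add: const Cont_iff)
  finally have "ennreal (L h) \<le> ennreal (L (g n) + e)"
    by (rule ennreal_leI)
  also have "\<dots> = ennreal (L (g n)) + ennreal e"
    using e g nonneg by (intro ennreal_plus) (auto simp: cover_def)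
  also have "\<dots> \<le> (SUP n. ennreal (L (g n))) + ennreal e"
    by (intro add_right_mono SUP_upper) simp
  finally show "ennreal (L h) \<le> (SUP n. ennreal (L (g n))) + ennreal e" .
qed

text \<open>The source of lower bounds for \<open>outer\<close>: \<open>h\<close> is a continuous
  minorant of the indicator of \<open>U\<close>.\<close>

lemma outer_ge:
  assumes "h \<in> Cont" "\<And>y. h y \<le> 1" "\<And>y. y \<notin> U \<Longrightarrow> h y \<le> 0"
  shows "ennreal (L h) \<le> outer U"
  unfolding outer_def by (intro INF_greatest cover_ge) (use assms in auto)

lemma outer_mono: "A \<subseteq> B \<Longrightarrow> outer A \<le> outer B"
  unfolding outer_def cover_def by (rule INF_superset_mono, blast) simp

lemma outer_UNIV: "outer UNIV = 1"
proof (rule antisym)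
  have "cover UNIV (\<lambda>_ _. 1)"
    by (auto simp: cover_def Cont_plus_iff incseq_def)
  then show "outer UNIV \<le> 1" by (rule outer_le) (simp add: one)
  show "1 \<le> outer UNIV"
    using outer_ge[of "\<lambda>_. 1" UNIV] by (simp add: one Cont_iff)
qed

lemma outer_empty: "outer {} = 0"
proof -
  have "cover {} (\<lambda>_ _. 0)"
    by (auto simp: cover_def Cont_plus_iff incseq_def)
  then have "outer {} \<le> 0" by (rule outer_le) (simp add: const)
  then show ?thesis by simp
qed

lemma outer_finite: "outer A < \<infinity>"
  using outer_mono[of A UNIV] by (simp add: outer_UNIV order_le_less_trans)

lemma outer_countably_subadditive: "outer (\<Union>i. A i) \<le> (\<Sum>i. outer (A i))"
proof (rule ennreal_le_epsilon)
  fix e :: real assume e: "0 < e"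
  \<comment> \<open>Errors e/2, e/4, ... with sum e. Finiteness of \<open>outer\<close> makes the
    next inequality strict, so a cover within \<open>d i\<close> of the infimum exists.\<close>
  define d where "d i = e * (1 / 2) ^ Suc i" for i :: nat
  have d: "0 < d i" for i using e by (simp add: d_def)
  have "\<exists>g. cover (A i) g \<and> (SUP n. ennreal (L (g n))) < outer (A i) + ennreal (d i)" for i
  proof -
    have "outer (A i) < outer (A i) + ennreal (d i)"
      using outer_finite[of "A i"] d[of i]
      by (cases "outer (A i)") (auto simp: ennreal_plus[symmetric] ennreal_less_iff simp del: ennreal_plus)
    then show ?thesis by (subst (asm) (1) outer_def) (auto simp: INF_less_iff)
  qed
  then obtain g where g: "\<And>i. cover (A i) (g i)"
    and lt: "\<And>i. (SUP n. ennreal (L (g i n))) < outer (A i) + ennreal (d i)"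
    by metis
  \<comment> \<open>Diagonal sum: stage n uses only the first n covers, so \<open>G n\<close> is
    continuous. It grows with n because the summands grow and the new ones are non-negative.\<close>
  define G where "G n y = (\<Sum>i<n. g i n y)" for n y
  have G: "cover (\<Union>i. A i) G"
    unfolding cover_def
  proof (intro conjI allI ballI)
    show "G n \<in> Cont_plus" for n
      unfolding Cont_plus_iff G_def
      using coverD(2,3)[OF g] by (auto intro!: continuous_intros sum_nonneg)
    show "incseq (\<lambda>n. G n y)" for y
    proof (rule incseq_SucI)
      fix n
      have "G n y \<le> (\<Sum>i<n. g i (Suc n) y)"
        unfolding G_def by (intro sum_mono coverD(4)[OF g]) simp
      then show "G n y \<le> G (Suc n) y"
        using coverD(3)[OF g, of n "Suc n" y] by (simp add: G_def)
    qed
    fix y assume "y \<in> (\<Union>i. A i)"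
    then obtain i where "y \<in> A i" by auto
    then obtain m where m: "1 \<le> g i m y" using g[of i] by (auto simp: cover_def)
    \<comment> \<open>The index m makes the i-th summand reach 1, and \<open>Suc i\<close> makes it
      occur in the sum.\<close>
    define n where "n = max m (Suc i)"
    have "1 \<le> g i n y" using coverD(4)[OF g, of m n i y] m by (simp add: n_def)
    also have "\<dots> \<le> G n y"
      unfolding G_def by (rule member_le_sum) (auto simp: n_def coverD(3)[OF g])
    finally show "\<exists>n. 1 \<le> G n y" ..
  qed
  have "outer (\<Union>i. A i) \<le> (\<Sum>i. outer (A i) + ennreal (d i))"
  proof (rule outer_le[OF G])
    fix n
    have "L (G n) = (\<Sum>i<n. L (g i n))"
      unfolding G_def by (rule sum) (rule coverD(1)[OF g])
    then have "ennreal (L (G n)) = (\<Sum>i<n. ennreal (L (g i n)))"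
      using g nonneg by (simp add: cover_def)
    also have "\<dots> \<le> (\<Sum>i<n. outer (A i) + ennreal (d i))"
      by (intro sum_mono order_trans[OF SUP_upper less_imp_le[OF lt]]) simp
    also have "\<dots> \<le> (\<Sum>i. outer (A i) + ennreal (d i))"
      by (rule sum_le_suminf) auto
    finally show "ennreal (L (G n)) \<le> (\<Sum>i. outer (A i) + ennreal (d i))" .
  qed
  also have "\<dots> = (\<Sum>i. outer (A i)) + (\<Sum>i. ennreal (d i))"
    by (rule suminf_add[symmetric]) auto
  also have "(\<Sum>i. ennreal (d i)) = ennreal e"
  proof -
    have "d sums e"
      unfolding d_def using sums_mult[OF power_half_series, of e] by simp
    with d show ?thesis by (intro suminf_ennreal_eq) (auto intro: less_imp_le)
  qed
  finally show "outer (\<Union>i. A i) \<le> (\<Sum>i. outer (A i)) + ennreal e" .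
qed

section \<open>Caratheodory measurability of open sets\<close>

lemma outer_measure_space_outer: "outer_measure_space (Pow UNIV) outer"
  by (auto simp: outer_measure_space_def positive_def increasing_def countably_subadditive_def
      outer_empty outer_mono outer_countably_subadditive)

text \<open>Cut-offs \<open>u k\<close> vanish off U and increase to 1 on U. A cover g of A is split
  into g_n u_n, which covers the part of A in U, and g_n (1 - u_k) with k fixed, which covers the
  rest. The index k must stay fixed in the second piece, since 1 - u_n decreases in n; hence the
  supremum over n is taken first and the one over k last.\<close>

lemma open_in_lambda_system:
  assumes "open U"
  shows "U \<in> lambda_system UNIV (Pow UNIV) outer"
proof -
  interpret S: sigma_algebra UNIV "Pow UNIV :: 'y set set" by (rule sigma_algebra_Pow)
  have sub: "subadditive (Pow UNIV) outer"
    using outer_measure_space_outer unfolding outer_measure_space_def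
    by (blast intro: S.countably_subadditive_subadditive)
  \<comment> \<open>The distance to the empty set is 0 by convention, so the whole space needs its
    own case.\<close>
  define h where "h y = (if U = UNIV then 1 else infdist y (- U))" for y
  have h: "continuous_on UNIV h" "\<And>y. 0 \<le> h y" "\<And>y. y \<notin> U \<Longrightarrow> h y = 0"
    unfolding h_def by (cases "U = UNIV"; auto intro!: continuous_intros infdist_nonneg)+
  have h_pos: "0 < h y" if "y \<in> U" for y
  proof (cases "U = UNIV")
    case False
    then have "infdist y (- U) \<noteq> 0"
      using in_closed_iff_infdist_zero[of "- U" y] that assms by auto
    then show ?thesis using False infdist_nonneg[of y "- U"] by (simp add: h_def)
  qed (simp add: h_def)
  define u where "u k y = min 1 (real k * h y)" for k :: nat and y
  have u: "continuous_on UNIV (u k)" "0 \<le> u k y" "u k y \<le> 1" for k y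
    unfolding u_def using h by (auto intro!: continuous_intros)
  have u_mono: "u j y \<le> u k y" if "j \<le> k" for j k y
    unfolding u_def using h(2) that by (intro min.mono mult_right_mono) auto
  have split: "outer (U \<inter> A) + outer (- U \<inter> A) \<le> outer A" for A
    unfolding outer_def[of A]
  proof (intro INF_greatest)
    fix g assume "g \<in> {g. cover A g}"
    then have g: "cover A g" by simp
    have gu: "cover (U \<inter> A) (\<lambda>n y. g n y * u n y)"
      unfolding cover_def
    proof (intro conjI allI ballI)
      fix y assume y: "y \<in> U \<inter> A"
      then obtain m where m: "1 \<le> g m y" using g by (auto simp: cover_def)
      obtain k where k: "1 \<le> real k * h y"
        using ex_less_of_nat_mult[of "h y" 1] h_pos[of y] y by (auto intro: less_imp_le)
      have "1 \<le> g (max m k) y"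
        using m coverD(4)[OF g, of m "max m k" y] by simp
      moreover have "u (max m k) y = 1"
        using u(3)[of "max m k" y] u_mono[of k "max m k" y] k by (simp add: u_def)
      ultimately show "\<exists>n. 1 \<le> g n y * u n y" by (intro exI[of _ "max m k"]) simp
    qed (use coverD[OF g] u u_mono in \<open>auto simp: Cont_plus_iff incseq_def intro!: continuous_intros mult_mono\<close>)
    have gv: "cover (- U \<inter> A) (\<lambda>n y. g n y * (1 - u k y))" for k
      unfolding cover_def
    proof (intro conjI allI ballI)
      fix y assume y: "y \<in> - U \<inter> A"
      then obtain m where m: "1 \<le> g m y" using g by (auto simp: cover_def)
      then show "\<exists>n. 1 \<le> g n y * (1 - u k y)"
        using y h(3)[of y] by (intro exI[of _ m]) (simp add: u_def)
    qed (use coverD[OF g] u in \<open>auto simp: Cont_plus_iff incseq_def intro!: continuous_intros mult_right_mono mult_nonneg_nonneg\<close>)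
    have key: "ennreal (L (\<lambda>y. g k y * u k y)) + outer (- U \<inter> A) \<le> (SUP n. ennreal (L (g n)))" for k
    proof -
      have "ennreal (L (\<lambda>y. g k y * u k y)) + outer (- U \<inter> A) \<le>
          ennreal (L (\<lambda>y. g k y * u k y)) + (SUP n. ennreal (L (\<lambda>y. g n y * (1 - u k y))))"
        by (intro add_left_mono outer_le[OF gv[of k]] SUP_upper) simp
      also have "\<dots> = (SUP n. ennreal (L (\<lambda>y. g k y * u k y)) + ennreal (L (\<lambda>y. g n y * (1 - u k y))))"
        by (rule ennreal_SUP_add_right) simp
      also have "\<dots> \<le> (SUP n. ennreal (L (g n)))"
      proof (rule SUP_least)
        fix n
        \<comment> \<open>Raising both indices to m can only increase the pieces, and then they add
          up to \<open>g m\<close> exactly.\<close>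
        define m where "m = max n k"
        have c: "(\<lambda>y. g i y * u j y) \<in> Cont" "(\<lambda>y. g i y * (1 - u j y)) \<in> Cont" for i j
          using coverD(2)[OF g] u(1) by (auto simp: Cont_iff intro!: continuous_intros)
        have "L (\<lambda>y. g k y * u k y) \<le> L (\<lambda>y. g m y * u k y)"
          by (intro mono c mult_right_mono coverD(4)[OF g] u(2)) (simp add: m_def)
        moreover have "L (\<lambda>y. g n y * (1 - u k y)) \<le> L (\<lambda>y. g m y * (1 - u k y))"
          using u(3) by (intro mono c mult_right_mono coverD(4)[OF g]) (simp_all add: m_def)
        moreover have "L (\<lambda>y. g m y * u k y) + L (\<lambda>y. g m y * (1 - u k y)) = L (g m)"
          by (subst add[symmetric, OF c]) (simp add: algebra_simps)
        ultimately have "L (\<lambda>y. g k y * u k y) + L (\<lambda>y. g n y * (1 - u k y)) \<le> L (g m)"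
          by simp
        moreover have "0 \<le> L (\<lambda>y. g k y * u k y)" "0 \<le> L (\<lambda>y. g n y * (1 - u k y))"
          using gu gv[of k] nonneg by (auto simp: cover_def)
        ultimately have "ennreal (L (\<lambda>y. g k y * u k y)) + ennreal (L (\<lambda>y. g n y * (1 - u k y)))
            \<le> ennreal (L (g m))"
          by (simp add: ennreal_plus[symmetric] ennreal_leI del: ennreal_plus)
        also have "\<dots> \<le> (SUP n. ennreal (L (g n)))" by (rule SUP_upper) simp
        finally show "ennreal (L (\<lambda>y. g k y * u k y)) + ennreal (L (\<lambda>y. g n y * (1 - u k y)))
            \<le> (SUP n. ennreal (L (g n)))" .
      qed
      finally show ?thesis .
    qed
    have "outer (U \<inter> A) + outer (- U \<inter> A) \<le>
        (SUP k. ennreal (L (\<lambda>y. g k y * u k y))) + outer (- U \<inter> A)"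
      by (intro add_right_mono outer_le[OF gu] SUP_upper) simp
    also have "\<dots> = (SUP k. ennreal (L (\<lambda>y. g k y * u k y)) + outer (- U \<inter> A))"
      by (rule ennreal_SUP_add_left[symmetric]) simp
    also have "\<dots> \<le> (SUP n. ennreal (L (g n)))"
      by (rule SUP_least) (rule key)
    finally show "outer (U \<inter> A) + outer (- U \<inter> A) \<le> (SUP n. ennreal (L (g n)))" .
  qed
  have "outer (U \<inter> A) + outer (- U \<inter> A) = outer A" for A
  proof (rule antisym[OF split])
    have "outer ((U \<inter> A) \<union> (- U \<inter> A)) \<le> outer (U \<inter> A) + outer (- U \<inter> A)"
      by (rule subadditiveD[OF sub]) auto
    also have "(U \<inter> A) \<union> (- U \<inter> A) = A" by auto
    finally show "outer A \<le> outer (U \<inter> A) + outer (- U \<inter> A)" .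
  qed
  then show ?thesis by (simp add: lambda_system_def Compl_eq_Diff_UNIV)
qed

definition riesz_measure :: "'y measure" where
  "riesz_measure = measure_of UNIV (sets borel) outer"

lemma sets_riesz_measure: "sets riesz_measure = sets borel"
  by (simp add: riesz_measure_def sets.sigma_sets_eq[of borel, simplified])

lemma space_riesz_measure: "space riesz_measure = UNIV"
  by (simp add: riesz_measure_def)

text \<open>The Caratheodory sigma-algebra contains the open sets, hence all Borel sets, and
  \<open>outer\<close> is a measure on it.\<close>

lemma emeasure_riesz_measure:
  assumes "A \<in> sets borel"
  shows "emeasure riesz_measure A = outer A"
proof -
  interpret S: sigma_algebra UNIV "Pow UNIV :: 'y set set" by (rule sigma_algebra_Pow)
  let ?N = "lambda_system UNIV (Pow UNIV) outer"
  have N: "measure_space UNIV ?N outer"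
    using S.caratheodory_lemma[OF outer_measure_space_outer] .
  then have "sigma_algebra UNIV ?N" by (simp add: measure_space_def)
  then have "sets borel \<subseteq> ?N"
    by (subst borel_def, subst sets_measure_of, simp)
      (rule sigma_algebra.sigma_sets_subset, auto simp only: mem_Collect_eq open_in_lambda_system)
  then have M: "measure_space UNIV (sets borel) outer"
    using measure_down[OF N] sets.sigma_algebra_axioms[of borel] by simp
  show ?thesis
    unfolding riesz_measure_def
  proof (rule emeasure_measure_of_sigma)
    show "sigma_algebra UNIV (sets (borel :: 'y measure))"
      using M by (simp add: measure_space_def)
  qed (use M assms in \<open>auto simp: measure_space_def\<close>)
qed

section \<open>Integrals against the representing measure\<close>

lemma riesz_measure_in_prob_measures: "riesz_measure \<in> prob_measures"
  unfolding prob_measures_def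
  by (auto intro!: prob_spaceI simp: sets_riesz_measure space_riesz_measure emeasure_riesz_measure outer_UNIV)

text \<open>Layer cake: n h is the sum of the slices c_i, each below the indicator of the open set
  U_i = {n h > i}, so that L(c_i) is at most the measure of U_i. The indicators of the U_i add up to
  at most n h + 1, and dividing by n leaves an error 1/n.\<close>

lemma riesz_measure_ge_unit:
  assumes h: "h \<in> Cont" "\<And>y. 0 \<le> h y" "\<And>y. h y \<le> 1"
  shows "L h \<le> (\<integral>y. h y \<partial>riesz_measure)"
proof (rule field_le_epsilon)
  fix e :: real assume "0 < e"
  then obtain n :: nat where n: "0 < n" "1 / real n < e"
    using nat_approx_posE[of e] by (metis zero_less_Suc)
  interpret prob_space riesz_measure
    using riesz_measure_in_prob_measures by (simp add: prob_measures_def)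
  define c where "c i y = min 1 (max 0 (real n * h y - real i))" for i :: nat and y
  define U where "U i = {y. real i < real n * h y}" for i :: nat
  have U_open: "open (U i)" for i
    unfolding U_def using h(1) by (intro open_Collect_less continuous_intros) (simp add: Cont_iff)
  then have U: "U i \<in> sets riesz_measure" for i
    by (simp add: sets_riesz_measure)
  have c: "c i \<in> Cont" for i
    unfolding c_def Cont_iff using h(1) by (intro continuous_intros) (simp add: Cont_iff)
  have "L (c i) \<le> measure riesz_measure (U i)" for i
  proof -
    have "ennreal (L (c i)) \<le> emeasure riesz_measure (U i)"
      using U_open c by (subst emeasure_riesz_measure) (auto intro!: outer_ge simp: c_def U_def)
    moreover have "0 \<le> L (c i)"
      using c[of i] by (intro nonneg) (auto simp: Cont_plus_iff Cont_iff c_def)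
    ultimately show ?thesis
      by (simp add: emeasure_eq_measure)
  qed
  then have "(\<Sum>i<n. L (c i)) \<le> (\<Sum>i<n. measure riesz_measure (U i))"
    by (rule sum_mono)
  also have "\<dots> = (\<integral>y. (\<Sum>i<n. indicator (U i) y) \<partial>riesz_measure)"
    using U by (subst Bochner_Integration.integral_sum) (auto simp: emeasure_eq_measure space_riesz_measure)
  also have "\<dots> \<le> (\<integral>y. real n * h y + 1 \<partial>riesz_measure)"
  proof (rule integral_mono)
    show "integrable riesz_measure (\<lambda>y. \<Sum>i<n. indicator (U i) y :: real)"
      using U by (auto simp: emeasure_eq_measure)
    show "integrable riesz_measure (\<lambda>y. real n * h y + 1)"
      using integrable_Cont[OF compact_space riesz_measure_in_prob_measures h(1)] by simp
    fix y
    \<comment> \<open>On \<open>U i\<close> the slice of n h + 1 is full, since n h + 1 - i exceeds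
      1 there. This shift is the origin of the error term.\<close>
    have "(\<Sum>i<n. indicator (U i) y :: real) \<le> (\<Sum>i<n. min 1 (max 0 (real n * h y + 1 - real i)))"
      by (intro sum_mono) (auto simp: U_def indicator_def)
    also have "\<dots> \<le> real n * h y + 1"
      using h(2)[of y] by (subst sum_clamp) auto
    finally show "(\<Sum>i<n. indicator (U i) y :: real) \<le> real n * h y + 1" .
  qed
  also have "\<dots> = real n * (\<integral>y. h y \<partial>riesz_measure) + 1"
    using integrable_Cont[OF compact_space riesz_measure_in_prob_measures h(1)] by (simp add: prob_space)
  also have "(\<Sum>i<n. L (c i)) = L (\<lambda>y. \<Sum>i<n. c i y)"
    by (rule sum[symmetric]) (rule c)
  also have "(\<lambda>y. \<Sum>i<n. c i y) = (\<lambda>y. real n * h y)"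
    unfolding c_def
  proof
    fix y
    have "real n * h y \<le> real n" "0 \<le> real n * h y" using h(2,3)[of y] by (auto intro: mult_left_le)
    then show "(\<Sum>i<n. min 1 (max 0 (real n * h y - real i))) = real n * h y"
      by (subst sum_clamp) auto
  qed
  also have "L (\<lambda>y. real n * h y) = real n * L h"
    by (rule scale[OF h(1)])
  finally have "L h \<le> (\<integral>y. h y \<partial>riesz_measure) + 1 / real n"
    using n(1) by (simp add: field_simps)
  with n(2) show "L h \<le> (\<integral>y. h y \<partial>riesz_measure) + e" by simp
qed

lemma riesz_measure_ge:
  assumes h: "h \<in> Cont"
  shows "L h \<le> (\<integral>y. h y \<partial>riesz_measure)"
proof -
  interpret prob_space riesz_measure
    using riesz_measure_in_prob_measures by (simp add: prob_measures_def)
  obtain M where M: "0 < M" "\<And>y. \<bar>h y\<bar> \<le> M" by (metis Cont_bounded[OF compact_space h])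
  \<comment> \<open>The affine map from [-M, M] onto [0, 1].\<close>
  define k where "k y = 1 / (2 * M) * (h y + M)" for y
  have hM: "(\<lambda>y. h y + M) \<in> Cont" using h by (auto simp: Cont_iff intro: continuous_intros)
  have "L k \<le> (\<integral>y. k y \<partial>riesz_measure)"
  proof (rule riesz_measure_ge_unit)
    show "k \<in> Cont" using h M(1) by (auto simp: Cont_iff k_def intro!: continuous_intros)
    fix y
    have "- M \<le> h y" "h y \<le> M" using M(2)[of y] by auto
    then show "0 \<le> k y" "k y \<le> 1" using M(1) by (auto simp: k_def field_simps)
  qed
  moreover have "L k = 1 / (2 * M) * (L h + M)"
    unfolding k_def using add[OF h, of "\<lambda>_. M"] by (subst scale[OF hM]) (simp add: const Cont_iff)
  moreover have "(\<integral>y. k y \<partial>riesz_measure) = 1 / (2 * M) * ((\<integral>y. h y \<partial>riesz_measure) + M)"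
    unfolding k_def using integrable_Cont[OF compact_space riesz_measure_in_prob_measures h]
    by (simp add: prob_space)
  ultimately show ?thesis using M(1) by (simp add: field_simps)
qed

text \<open>The one-sided estimate for \<open>- h\<close> is the missing half for
  \<open>h\<close>.\<close>

theorem riesz_representation:
  assumes h: "h \<in> Cont"
  shows "(\<integral>y. h y \<partial>riesz_measure) = L h"
proof (rule antisym)
  have "(\<lambda>y. - h y) \<in> Cont" using h by (auto simp: Cont_iff intro: continuous_intros)
  from riesz_measure_ge[OF this] show "(\<integral>y. h y \<partial>riesz_measure) \<le> L h"
    by (simp add: minus[OF h])
qed (rule riesz_measure_ge[OF h])

end

section \<open>Sublinear functionals and Kantorovich operators as suprema of integrals\<close>

text \<open>Lying below \<open>p\<close> forces a linear L to be positive and normalised: L(- g)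
  \<le> p(0) = 0 for g \<ge> 0, while L(1) \<le> 1 and L(- 1) \<le> - 1. Riesz then turns the
  Hahn-Banach functional into a probability measure.\<close>

lemma sublinear_functional_representation:
  fixes p :: "('y::metric_space \<Rightarrow> real) \<Rightarrow> real"
  assumes compact: "compact (UNIV :: 'y set)"
    and mono: "\<And>g h. g \<in> Cont \<Longrightarrow> h \<in> Cont \<Longrightarrow> (\<And>y. g y \<le> h y) \<Longrightarrow> p g \<le> p h"
    and add: "\<And>g h. g \<in> Cont \<Longrightarrow> h \<in> Cont \<Longrightarrow> p (\<lambda>y. g y + h y) \<le> p g + p h"
    and scale: "\<And>g t. g \<in> Cont \<Longrightarrow> 0 \<le> t \<Longrightarrow> p (\<lambda>y. t * g y) = t * p g"
    and const: "\<And>c. p (\<lambda>_. c) = c"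
    and f: "f \<in> Cont"
  obtains \<sigma> where "\<sigma> \<in> prob_measures" "(\<integral>y. f y \<partial>\<sigma>) = p f"
    "\<And>h. h \<in> Cont \<Longrightarrow> (\<integral>y. h y \<partial>\<sigma>) \<le> p h"
proof -
  \<comment> \<open>Bounded continuous functions form the vector space for Hahn-Banach; by
    compactness they exhaust C(Y).\<close>
  have B: "apply_bcontfun (Bcontfun g) = g" if g: "g \<in> Cont" for g :: "'y \<Rightarrow> real"
  proof (rule Bcontfun_inverse)
    have "bounded (range g)"
      using g compact_continuous_image[OF _ compact, of g] by (simp add: Cont_iff compact_imp_bounded)
    then show "g \<in> bcontfun" using g by (simp add: bcontfun_def Cont_iff)
  qed
  have apply_Cont: "apply_bcontfun b \<in> Cont" for b :: "'y \<Rightarrow>\<^sub>C real"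
    by (simp add: Cont_iff)
  have "sublinear (\<lambda>b. p (apply_bcontfun b))"
    by (auto simp: sublinear_def plus_bcontfun.rep_eq scaleR_bcontfun.rep_eq
        intro!: add scale apply_Cont)
  then obtain l where l: "linear l" "l \<le> (\<lambda>b. p (apply_bcontfun b))"
    and lf: "l (Bcontfun f) = p (apply_bcontfun (Bcontfun f))"
    by (rule sublinear_supporting_linear)
  define L where "L g = l (Bcontfun g)" for g
  have L_le: "L g \<le> p g" if "g \<in> Cont" for g
    using l(2) B[OF that] by (metis L_def le_funD)
  have L_add: "L (\<lambda>y. g y + h y) = L g + L h" if "g \<in> Cont" "h \<in> Cont" for g h
  proof -
    have "(\<lambda>y. g y + h y) \<in> Cont" using that by (auto simp: Cont_iff intro: continuous_intros)
    then have "Bcontfun (\<lambda>y. g y + h y) = Bcontfun g + Bcontfun h"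
      using that by (intro bcontfun_eqI) (simp add: B plus_bcontfun.rep_eq)
    then show ?thesis by (simp add: L_def linear_add[OF l(1)])
  qed
  have L_scale: "L (\<lambda>y. c * g y) = c * L g" if "g \<in> Cont" for g c
  proof -
    have "(\<lambda>y. c * g y) \<in> Cont" using that by (auto simp: Cont_iff intro: continuous_intros)
    then have "Bcontfun (\<lambda>y. c * g y) = c *\<^sub>R Bcontfun g"
      using that by (intro bcontfun_eqI) (simp add: B scaleR_bcontfun.rep_eq)
    then show ?thesis by (simp add: L_def linear_scale[OF l(1)])
  qed
  interpret positive_functional L
  proof
    fix g :: "'y \<Rightarrow> real" assume g: "g \<in> Cont_plus"
    then have gC: "g \<in> Cont" "(\<lambda>y. - 1 * g y) \<in> Cont"
      by (auto simp: Cont_plus_iff Cont_iff intro!: continuous_intros)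
    have "L (\<lambda>y. - 1 * g y) \<le> p (\<lambda>_. 0)"
      using g by (intro order_trans[OF L_le[OF gC(2)]] mono gC) (auto simp: Cont_plus_iff Cont_iff)
    then show "0 \<le> L g" using L_scale[OF gC(1), of "- 1"] by (simp add: const)
  next
    have "(\<lambda>_::'y. 1) \<in> Cont" "(\<lambda>_::'y. - 1) \<in> Cont" by (simp_all add: Cont_iff)
    then show "L (\<lambda>_. 1) = 1"
      using L_le[of "\<lambda>_. 1"] L_le[of "\<lambda>_. - 1"] L_scale[of "\<lambda>_. 1" "- 1"] by (simp add: const)
  qed (simp_all add: compact L_add L_scale)
  show thesis
  proof (rule that)
    show "riesz_measure \<in> prob_measures" by (rule riesz_measure_in_prob_measures)
    show "(\<integral>y. f y \<partial>riesz_measure) = p f"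
      using riesz_representation[OF f] lf by (simp add: L_def B[OF f])
    show "(\<integral>y. h y \<partial>riesz_measure) \<le> p h" if "h \<in> Cont" for h
      using riesz_representation[OF that] L_le[OF that] by simp
  qed
qed

section \<open>Backward Kantorovich operators evaluated at a point\<close>

lemma backward_KantorovichD:
  assumes "backward_Kantorovich S"
  shows "g \<in> Cont \<Longrightarrow> S g \<in> USC"
    and "g \<in> Cont \<Longrightarrow> h \<in> Cont \<Longrightarrow> (\<And>y. g y \<le> h y) \<Longrightarrow> S g x \<le> S h x"
    and "g \<in> Cont \<Longrightarrow> S (\<lambda>y. g y + c) x = S g x + ereal c"
    and "g \<in> Cont \<Longrightarrow> h \<in> Cont \<Longrightarrow> 0 \<le> t \<Longrightarrow> t \<le> 1 \<Longrightarrow>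
      S (\<lambda>y. t * g y + (1 - t) * h y) x \<le> ereal t * S g x + ereal (1 - t) * S h x"
  using assms unfolding backward_Kantorovich_def by (auto simp: le_fun_def)

lemma pos_homogenous_kantD:
  "pos_homogenous_kant S \<Longrightarrow> g \<in> Cont \<Longrightarrow> 0 \<le> t \<Longrightarrow> S (\<lambda>y. t * g y) x = ereal t * S g x"
  unfolding pos_homogenous_kant_def by blast

lemma pos_homogenous_kant_const:
  assumes "backward_Kantorovich S" "pos_homogenous_kant S"
  shows "S (\<lambda>_. c) x = ereal c"
proof -
  have C: "(\<lambda>_. 0) \<in> Cont" by (simp add: Cont_iff)
  \<comment> \<open>Homogeneity with factor 0 suffices: in ereal, zero times an infinite value is
    still zero.\<close>
  have "S (\<lambda>_. 0) x = 0"
    using pos_homogenous_kantD[OF assms(2) C, of 0 x] by (simp flip: zero_ereal_def)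
  then show ?thesis using backward_KantorovichD(3)[OF assms(1) C, of c x] by simp
qed

text \<open>Monotonicity traps S g x between the constants - M and M, so S at x is a real-valued
  functional to which the sublinear representation applies.\<close>

lemma backward_Kantorovich_representation:
  fixes S :: "('y::metric_space \<Rightarrow> real) \<Rightarrow> 'x::topological_space \<Rightarrow> ereal"
  assumes compact: "compact (UNIV :: 'y set)"
    and S: "backward_Kantorovich S" "pos_homogenous_kant S" and f: "f \<in> Cont"
  obtains \<sigma> where "\<sigma> \<in> prob_measures" "ereal (\<integral>y. f y \<partial>\<sigma>) = S f x"
    "\<And>h. h \<in> Cont \<Longrightarrow> ereal (\<integral>y. h y \<partial>\<sigma>) \<le> S h x"
proof -
  define p where "p g = real_of_ereal (S g x)" for g
  have p: "S g x = ereal (p g)" if g: "g \<in> Cont" for g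
  proof -
    obtain M where M: "\<And>y. \<bar>g y\<bar> \<le> M" by (metis Cont_bounded[OF compact g])
    have gM: "- M \<le> g y" "g y \<le> M" for y using M[of y] by auto
    have "S (\<lambda>_. - M) x \<le> S g x" "S g x \<le> S (\<lambda>_. M) x"
      using gM g by (auto intro!: backward_KantorovichD(2)[OF S(1)] simp: Cont_iff)
    then have "\<bar>S g x\<bar> \<noteq> \<infinity>"
      unfolding pos_homogenous_kant_const[OF S] by auto
    then show ?thesis by (simp add: p_def ereal_real')
  qed
  have "p g \<le> p h" if "g \<in> Cont" "h \<in> Cont" "\<And>y. g y \<le> h y" for g h
    using backward_KantorovichD(2)[OF S(1) that, of x] that by (simp add: p)
  moreover have scale: "p (\<lambda>y. t * g y) = t * p g" if g: "g \<in> Cont" and t: "0 \<le> t" for g t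
  proof -
    have "(\<lambda>y. t * g y) \<in> Cont" using g by (auto simp: Cont_iff intro: continuous_intros)
    then show ?thesis using pos_homogenous_kantD[OF S(2) g t, of x] g by (simp add: p)
  qed
  moreover have "p (\<lambda>y. g y + h y) \<le> p g + p h" if g: "g \<in> Cont" and h: "h \<in> Cont" for g h
  proof -
    \<comment> \<open>Subadditivity is convexity at 1/2 followed by scaling with 2.\<close>
    let ?m = "\<lambda>y. 1 / 2 * g y + (1 - 1 / 2) * h y"
    have m: "?m \<in> Cont" using g h by (auto simp: Cont_iff intro!: continuous_intros)
    have "p ?m \<le> 1 / 2 * p g + (1 - 1 / 2) * p h"
      using backward_KantorovichD(4)[OF S(1) g h, of "1 / 2" x] m g h
      by (simp only: p times_ereal.simps plus_ereal.simps ereal_less_eq)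
    then show ?thesis using scale[OF m, of 2] by (simp add: algebra_simps)
  qed
  moreover have "p (\<lambda>_. c) = c" for c
    by (simp add: p_def pos_homogenous_kant_const[OF S])
  ultimately obtain \<sigma> where "\<sigma> \<in> prob_measures" "(\<integral>y. f y \<partial>\<sigma>) = p f"
    "\<And>h. h \<in> Cont \<Longrightarrow> (\<integral>y. h y \<partial>\<sigma>) \<le> p h"
    using sublinear_functional_representation[OF compact, of p f] f by blast
  with f show thesis by (intro that[of \<sigma>]) (auto simp: p)
qed

section \<open>Upper semicontinuous functions and domination\<close>

lemma le_ennreal_if: "enn2ereal a \<le> ereal r \<Longrightarrow> a \<le> ennreal r"
  using e2ennreal_mono[of "enn2ereal a" "ereal r"] by simp

lemma le_enn2ereal_INF:
  assumes "\<And>n. c \<le> enn2ereal (a n)"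
  shows "c \<le> enn2ereal (INF n. a n)"
proof (cases "0 \<le> c")
  case True
  have "e2ennreal c \<le> a n" for n
    using e2ennreal_mono[OF assms[of n]] by simp
  then have "e2ennreal c \<le> (INF n. a n)" by (rule INF_greatest)
  then show ?thesis using True by (simp add: less_eq_ennreal.rep_eq enn2ereal_e2ennreal)
next
  case False
  then show ?thesis using order_trans[of c 0] by simp
qed

lemma USC_plusI:
  assumes "\<And>c. open {y. f y < c}" and "\<And>y. f y \<le> ennreal M"
  shows "f \<in> USC_plus"
proof -
  have "open {y. enn2ereal (f y) < c}" for c
  proof (cases "0 \<le> c")
    case True
    then have "{y. enn2ereal (f y) < c} = {y. f y < e2ennreal c}"
      by (simp add: less_ennreal.rep_eq enn2ereal_e2ennreal)
    then show ?thesis using assms(1) by simp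
  next
    case False
    then have "\<not> enn2ereal (f y) < c" for y
      using enn2ereal_nonneg[of "f y"] by (meson not_le order_trans less_imp_le)
    then show ?thesis by simp
  qed
  moreover have "enn2ereal (f y) \<le> ereal (max 0 M)" for y
    using assms(2)[of y] by (simp add: less_eq_ennreal.rep_eq ennreal.rep_eq max_def zero_ereal_def split: if_splits)
  moreover have "enn2ereal (f y) \<noteq> - \<infinity>" for y
    using enn2ereal_nonneg[of "f y"] by auto
  ultimately show ?thesis
    unfolding USC_plus_def USC_def upper_semicontinuous_def by blast
qed

lemma USC_plusE:
  assumes "f \<in> USC_plus"
  obtains M where "0 \<le> M" "\<And>y. f y \<le> ennreal M"
proof -
  obtain M where "\<And>y. enn2ereal (f y) \<le> ereal M"
    using assms by (auto simp: USC_plus_def USC_def)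
  then have "f y \<le> ennreal (max 0 M)" for y
    by (intro le_ennreal_if, rule order_trans[of _ "ereal M"]) auto
  then show thesis by (intro that[of "max 0 M"]) auto
qed

lemma USC_plus_open:
  assumes "f \<in> USC_plus"
  shows "open {y. f y < c}"
  using assms by (auto simp: USC_plus_def USC_def upper_semicontinuous_def less_ennreal.rep_eq)

lemma indicator_USC_plus:
  assumes "closed K"
  shows "indicator K \<in> USC_plus"
proof (rule USC_plusI[where M = 1])
  fix c :: ennreal
  have "{y. indicator K y < c} = (if c \<le> 0 then {} else if c \<le> 1 then - K else UNIV)"
    by (auto simp: indicator_def not_le zero_less_iff_neq_zero)
  then show "open {y. indicator K y < c}" using assms by auto
qed (simp add: indicator_def)

lemma enn2ereal_indicator_le: "enn2ereal (indicator K y) \<le> ereal r \<longleftrightarrow> indicator K y \<le> r"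
  by (cases "y \<in> K") (simp_all add: one_ennreal.rep_eq zero_ennreal.rep_eq one_ereal_def zero_ereal_def)

lemma Cont_plus_USC_plus:
  fixes h :: "'y::topological_space \<Rightarrow> real"
  assumes "compact (UNIV :: 'y set)" and "h \<in> Cont_plus"
  shows "(\<lambda>y. ennreal (h y)) \<in> USC_plus"
proof -
  have h: "continuous_on UNIV h" using assms(2) by (simp add: Cont_plus_iff)
  obtain M where "\<And>y. \<bar>h y\<bar> \<le> M" using Cont_bounded[OF assms(1)] h by (metis Cont_iff)
  then have "h y \<le> M" for y by (meson abs_le_D1)
  then show ?thesis
    using h by (intro USC_plusI[where M = M] open_Collect_less continuous_intros continuous_on_ennreal ennreal_leI) auto
qed

lemma compact_superlevel:
  fixes f :: "'y::topological_space \<Rightarrow> ennreal"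
  assumes "compact (UNIV :: 'y set)" and "f \<in> USC_plus"
  shows "compact {y. c \<le> f y}"
proof -
  have "{y. c \<le> f y} = - {y. f y < c}" by auto
  then have "closed {y. c \<le> f y}" using USC_plus_open[OF assms(2)] by (simp add: closed_Compl)
  then show ?thesis using compact_Int_closed[OF assms(1)] by simp
qed

lemma nn_integral_le_Cont:
  assumes "compact (UNIV :: 'y::topological_space set)" and \<sigma>: "\<sigma> \<in> (prob_measures :: 'y measure set)"
    and h: "h \<in> Cont" and le: "\<And>y. enn2ereal (f y) \<le> ereal (h y)"
  shows "enn2ereal (\<integral>\<^sup>+y. f y \<partial>\<sigma>) \<le> ereal (\<integral>y. h y \<partial>\<sigma>)"
proof -
  have h0: "0 \<le> h y" for y
    using order_trans[OF enn2ereal_nonneg le] by simp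
  have "(\<integral>\<^sup>+y. f y \<partial>\<sigma>) \<le> (\<integral>\<^sup>+y. ennreal (h y) \<partial>\<sigma>)"
    by (intro nn_integral_mono le_ennreal_if le)
  also have "\<dots> = ennreal (\<integral>y. h y \<partial>\<sigma>)"
    using integrable_Cont[OF assms(1) \<sigma> h] h0 by (intro nn_integral_eq_integral) auto
  finally have "enn2ereal (\<integral>\<^sup>+y. f y \<partial>\<sigma>) \<le> enn2ereal (ennreal (\<integral>y. h y \<partial>\<sigma>))"
    by (simp add: less_eq_ennreal.rep_eq)
  then show ?thesis using h0 by (simp add: enn2ereal_ennreal)
qed

text \<open>The extension is an infimum over continuous majorants of \<open>f\<close>, and each of
  them already bounds the integral of \<open>f\<close>.\<close>

lemma nn_integral_le_kant_fun:
  assumes "compact (UNIV :: 'y::topological_space set)" and "\<sigma> \<in> (prob_measures :: 'y measure set)"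
    and "\<And>h. h \<in> Cont \<Longrightarrow> ereal (\<integral>y. h y \<partial>\<sigma>) \<le> S h x"
  shows "enn2ereal (\<integral>\<^sup>+y. f y \<partial>\<sigma>) \<le> kant_fun S f x"
  unfolding kant_fun_def usc_ext_def
  by (rule INF_greatest) (use nn_integral_le_Cont[OF assms(1,2)] assms(3) order_trans in blast)

lemma emeasure_compact_eq_nn_integral:
  fixes K :: "'y::t2_space set"
  assumes "\<sigma> \<in> prob_measures" "compact K"
  shows "emeasure \<sigma> K = (\<integral>\<^sup>+y. indicator K y \<partial>\<sigma>)"
  using assms by (simp add: prob_measures_def compact_imp_closed)

lemma dominated_at_kant_fun:
  assumes "compact (UNIV :: 'y::t2_space set)" and "\<sigma> \<in> (prob_measures :: 'y measure set)"
    and "\<And>h. h \<in> Cont \<Longrightarrow> ereal (\<integral>y. h y \<partial>\<sigma>) \<le> S h x"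
  shows "dominated_at \<sigma> (kant_fun S) x"
  unfolding dominated_at_def
  using nn_integral_le_kant_fun[where \<sigma> = \<sigma> and S = S and x = x, OF assms]
    emeasure_compact_eq_nn_integral[OF assms(2)] by simp

lemma kant_fun_Cont_plus:
  assumes "backward_Kantorovich S" "g \<in> Cont_plus"
  shows "kant_fun S (\<lambda>y. ennreal (g y)) x = S g x"
  unfolding kant_fun_def usc_ext_def
proof (rule antisym)
  have g: "g \<in> Cont" "\<And>y. enn2ereal (ennreal (g y)) = ereal (g y)"
    using assms(2) by (auto simp: Cont_plus_def enn2ereal_ennreal)
  show "(INF h\<in>{h \<in> Cont. \<forall>y. enn2ereal (ennreal (g y)) \<le> ereal (h y)}. S h x) \<le> S g x"
    using g by (intro INF_lower) simp
  show "S g x \<le> (INF h\<in>{h \<in> Cont. \<forall>y. enn2ereal (ennreal (g y)) \<le> ereal (h y)}. S h x)"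
    using g by (intro INF_greatest backward_KantorovichD(2)[OF assms(1)]) auto
qed

lemma kant_fun_le:
  assumes "h \<in> Cont" "\<And>y. enn2ereal (f y) \<le> ereal (h y)"
  shows "kant_fun S f x \<le> S h x"
  unfolding kant_fun_def usc_ext_def by (rule INF_lower) (use assms in simp)

lemma saturated_integral_le:
  fixes \<Phi> :: "('y::topological_space \<Rightarrow> ennreal) \<Rightarrow> 'x \<Rightarrow> ereal"
  assumes "compact (UNIV :: 'y set)" and "saturated \<Phi>" and \<sigma>: "\<sigma> \<in> prob_measures"
    and "dominated_at \<sigma> \<Phi> x" and h: "h \<in> Cont_plus"
  shows "ereal (\<integral>y. h y \<partial>\<sigma>) \<le> \<Phi> (\<lambda>y. ennreal (h y)) x"
proof -
  have "enn2ereal (\<integral>\<^sup>+y. ennreal (h y) \<partial>\<sigma>) \<le> \<Phi> (\<lambda>y. ennreal (h y)) x"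
    using assms Cont_plus_USC_plus[OF assms(1) h] unfolding saturated_def by blast
  moreover have "(\<integral>\<^sup>+y. ennreal (h y) \<partial>\<sigma>) = ennreal (\<integral>y. h y \<partial>\<sigma>)"
    using integrable_Cont[OF assms(1) \<sigma>] h by (intro nn_integral_eq_integral) (auto simp: Cont_plus_def)
  ultimately show ?thesis
    using h by (simp add: enn2ereal_ennreal Cont_plus_def)
qed

section \<open>Approximation of compact sets and upper semicontinuous functions from above\<close>

lemma compact_Cont_approx:
  fixes K :: "'y::metric_space set"
  assumes "compact (UNIV :: 'y set)" and "compact K"
  obtains h :: "nat \<Rightarrow> 'y \<Rightarrow> real" and C :: "nat \<Rightarrow> 'y set" where
    "\<And>n. h n \<in> Cont" "\<And>n y. indicator K y \<le> h n y" "\<And>n y. h n y \<le> indicator (C n) y"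
    "\<And>n. compact (C n)" "decseq C" "(\<Inter>n. C n) = K"
proof (cases "K = {}")
  \<comment> \<open>For empty K the distance function is 0 by convention, and the sets below would
    be the whole space.\<close>
  case True
  show thesis
    by (rule that[of "\<lambda>_ _. 0" "\<lambda>_. {}"]) (auto simp: True Cont_iff decseq_def)
next
  case False
  have K: "closed K" using assms(2) by (rule compact_imp_closed)
  \<comment> \<open>A tent of slope n + 1, vanishing outside the closed 1/(n + 1)-neighbourhood
    \<open>C n\<close> of K.\<close>
  define h where "h n y = max 0 (1 - real (Suc n) * infdist y K)" for n y
  define C where "C n = {y. real (Suc n) * infdist y K \<le> 1}" for n
  show thesis
  proof (rule that[of h C])
    show "h n \<in> Cont" for n
      unfolding h_def Cont_iff by (intro continuous_intros)
    show "indicator K y \<le> h n y" for n y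
      by (auto simp: h_def indicator_def)
    show "h n y \<le> indicator (C n) y" for n y
      using infdist_nonneg[of y K] by (auto simp: h_def C_def indicator_def)
    have "closed (C n)" for n
      unfolding C_def by (intro closed_Collect_le continuous_intros)
    then show "compact (C n)" for n
      using compact_Int_closed[OF assms(1)] by simp
    show "decseq C"
    proof (rule decseq_SucI, rule subsetI)
      fix n y assume "y \<in> C (Suc n)"
      then show "y \<in> C n"
        using mult_right_mono[OF _ infdist_nonneg[of y K], of "real (Suc n)" "real (Suc (Suc n))"]
        by (simp add: C_def)
    qed
    show "(\<Inter>n. C n) = K"
    proof
      show "K \<subseteq> (\<Inter>n. C n)" by (auto simp: C_def)
      show "(\<Inter>n. C n) \<subseteq> K"
      proof
        fix y assume y: "y \<in> (\<Inter>n. C n)"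
        have "infdist y K = 0"
        proof (rule ccontr)
          assume "infdist y K \<noteq> 0"
          then have "0 < infdist y K" using infdist_nonneg[of y K] by simp
          then obtain n where "1 < real n * infdist y K" using reals_Archimedean3 by blast
          also have "\<dots> \<le> real (Suc n) * infdist y K"
            by (intro mult_right_mono infdist_nonneg) simp
          also have "\<dots> \<le> 1" using y by (auto simp: C_def)
          finally show False by simp
        qed
        then show "y \<in> K" using in_closed_iff_infdist_zero[OF K False] by simp
      qed
    qed
  qed
qed

text \<open>Sup-convolution with the kernel n d(y, z) produces n-Lipschitz majorants that decrease
  in n. Convergence to \<open>f\<close> at y uses upper semicontinuity for z near y and the bound on
  \<open>f\<close> for z far away.\<close>

lemma USC_plus_Cont_approx:
  fixes f :: "'y::metric_space \<Rightarrow> ennreal"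
  assumes f: "f \<in> USC_plus"
  obtains h :: "nat \<Rightarrow> 'y \<Rightarrow> real" where
    "\<And>n. h n \<in> Cont_plus" "\<And>n y. f y \<le> ennreal (h n y)" "\<And>y. decseq (\<lambda>n. h n y)"
    "\<And>y. (INF n. ennreal (h n y)) = f y"
proof -
  obtain M where M: "0 \<le> M" "\<And>y. f y \<le> ennreal M" using USC_plusE[OF f] by metis
  define F where "F y = enn2real (f y)" for y
  have fF: "f y = ennreal (F y)" for y
    using M(2)[of y] unfolding F_def by (subst ennreal_enn2real) (auto simp: le_less_trans)
  have F: "0 \<le> F y" "F y \<le> M" for y
    using M(1) M(2)[of y] by (simp_all add: F_def enn2real_leI)
  define h where "h n y = (SUP z. F z - real n * dist y z)" for n y
  have "F z - real n * dist y z \<le> M" for n y z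
    using F(2)[of z] mult_nonneg_nonneg[OF of_nat_0_le_iff zero_le_dist, of n y z] by linarith
  then have bdd: "bdd_above (range (\<lambda>z. F z - real n * dist y z))" for n y
    by (intro bdd_aboveI2)
  have h_upper: "F z - real n * dist y z \<le> h n y" for n y z
    unfolding h_def by (rule cSUP_upper[OF _ bdd]) simp
  have h_least: "h n y \<le> c" if "\<And>z. F z - real n * dist y z \<le> c" for n y c
    unfolding h_def by (rule cSUP_least) (use that in auto)
  have F_le: "F y \<le> h n y" for n y using h_upper[of y n y] by simp
  have lip: "h n y \<le> h n y' + real n * dist y y'" for n y y'
  proof (rule h_least)
    fix z
    have "real n * dist y' z \<le> real n * (dist y y' + dist y z)"
      by (intro mult_left_mono dist_triangle3) simp
    then show "F z - real n * dist y z \<le> h n y' + real n * dist y y'"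
      using h_upper[of z n y'] by (simp add: algebra_simps)
  qed
  show thesis
  proof (rule that[of h])
    fix n
    have "(real n)-lipschitz_on UNIV (h n)"
    proof (rule lipschitz_onI)
      fix y y'
      show "dist (h n y) (h n y') \<le> real n * dist y y'"
        using lip[of n y y'] lip[of n y' y] by (simp add: dist_real_def abs_le_iff dist_commute)
    qed simp
    then show "h n \<in> Cont_plus"
      using F_le F(1) by (auto simp: Cont_plus_iff lipschitz_on_continuous_on intro: order_trans)
    show "f y \<le> ennreal (h n y)" for y
      unfolding fF by (intro ennreal_leI F_le)
  next
    fix y
    show dec: "decseq (\<lambda>n. h n y)"
    proof (rule decseq_SucI, rule h_least)
      fix n z
      show "F z - real (Suc n) * dist y z \<le> h n y"
        using h_upper[of z n y] zero_le_dist[of y z] unfolding of_nat_Suc distrib_right by linarith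
    qed
    show "(INF n. ennreal (h n y)) = f y"
    proof (rule antisym)
      show "f y \<le> (INF n. ennreal (h n y))"
        unfolding fF by (intro INF_greatest ennreal_leI F_le)
      show "(INF n. ennreal (h n y)) \<le> f y"
        unfolding fF
      proof (rule ennreal_le_epsilon)
        fix e :: real assume e: "0 < e"
        have "f y < ennreal (F y + e)"
          using F(1)[of y] e by (simp add: fF ennreal_less_iff)
        then have "y \<in> {z. f z < ennreal (F y + e)}" by simp
        then have "\<exists>d>0. \<forall>z. dist z y < d \<longrightarrow> z \<in> {z. f z < ennreal (F y + e)}"
          using USC_plus_open[OF f, of "ennreal (F y + e)"] unfolding open_dist by (rule bspec[rotated])
        then obtain d where d: "0 < d" "\<And>z. dist z y < d \<Longrightarrow> f z < ennreal (F y + e)"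
          by auto
        \<comment> \<open>Points at distance at least d then contribute at most M - n d < 0, so only
          points near y matter.\<close>
        obtain n where n: "M < real n * d" using reals_Archimedean3[OF d(1)] by blast
        have "h n y \<le> F y + e"
        proof (rule h_least)
          fix z
          show "F z - real n * dist y z \<le> F y + e"
          proof (cases "dist z y < d")
            case True
            then have "F z < F y + e"
              using d(2)[of z] F(1)[of z] by (simp add: fF ennreal_less_iff)
            then show ?thesis
              using mult_nonneg_nonneg[OF of_nat_0_le_iff zero_le_dist, of n y z] by linarith
          next
            case False
            then have "real n * d \<le> real n * dist y z"
              by (intro mult_left_mono) (auto simp: dist_commute)
            then show ?thesis using n F(2)[of z] F(1)[of y] e by simp
          qed
        qed
        then have "ennreal (h n y) \<le> ennreal (F y) + ennreal e"
          using F(1)[of y] e by (simp add: ennreal_plus[symmetric] ennreal_leI del: ennreal_plus)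
        then show "(INF n. ennreal (h n y)) \<le> ennreal (F y) + ennreal e"
          by (rule INF_lower2[OF UNIV_I])
      qed
    qed
  qed
qed

section \<open>The Choquet extension\<close>

text \<open>Superlevel sets of an upper semicontinuous function on a compact space are compact, so
  the order on compact sets compares the integrands pointwise.\<close>

lemma choquet_mono:
  fixes \<Phi> \<Psi> :: "('y::topological_space \<Rightarrow> ennreal) \<Rightarrow> 'x \<Rightarrow> ereal"
  assumes "compact (UNIV :: 'y set)" and "le_compact \<Phi> \<Psi>"
  shows "le_USC_plus (choquet \<Phi>) (choquet \<Psi>)"
  unfolding le_USC_plus_def choquet_def
proof (intro ballI allI)
  fix f :: "'y \<Rightarrow> ennreal" and x assume f: "f \<in> USC_plus"
  have "(\<integral>\<^sup>+\<alpha>\<in>{0..}. e2ennreal (\<Phi> (indicator {y. ennreal \<alpha> \<le> f y}) x) \<partial>lborel)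
      \<le> (\<integral>\<^sup>+\<alpha>\<in>{0..}. e2ennreal (\<Psi> (indicator {y. ennreal \<alpha> \<le> f y}) x) \<partial>lborel)"
    using assms(2) compact_superlevel[OF assms(1) f]
    by (intro nn_integral_mono mult_right_mono e2ennreal_mono) (auto simp: le_compact_def)
  then show "enn2ereal (\<integral>\<^sup>+\<alpha>\<in>{0..}. e2ennreal (\<Phi> (indicator {y. ennreal \<alpha> \<le> f y}) x) \<partial>lborel)
      \<le> enn2ereal (\<integral>\<^sup>+\<alpha>\<in>{0..}. e2ennreal (\<Psi> (indicator {y. ennreal \<alpha> \<le> f y}) x) \<partial>lborel)"
    by (simp add: less_eq_ennreal.rep_eq)
qed

text \<open>The superlevel set of the indicator is K for 0 < \<alpha> \<le> 1 and empty for \<alpha>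
  > 1. This recovers the order on compact sets from the order of Choquet extensions.\<close>

lemma choquet_indicator:
  assumes "\<Phi> (indicator {}) x = 0" and "0 \<le> \<Phi> (indicator K) x"
  shows "choquet \<Phi> (indicator K) x = \<Phi> (indicator K) x"
proof -
  let ?c = "e2ennreal (\<Phi> (indicator K) x)"
  have "(\<integral>\<^sup>+\<alpha>\<in>{0..}. e2ennreal (\<Phi> (indicator {y. ennreal \<alpha> \<le> indicator K y}) x) \<partial>lborel)
      = (\<integral>\<^sup>+\<alpha>. ?c * indicator {0<..1::real} \<alpha> \<partial>lborel)"
  proof (rule nn_integral_cong_AE)
    \<comment> \<open>At \<alpha> = 0 the superlevel set is the whole space, but a single point is
      negligible.\<close>
    have "AE \<alpha> in lborel. \<alpha> \<noteq> (0::real)" by (rule AE_lborel_singleton)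
    then show "AE \<alpha> in lborel. e2ennreal (\<Phi> (indicator {y. ennreal \<alpha> \<le> indicator K y}) x) *
        indicator {0..} \<alpha> = ?c * indicator {0<..1::real} \<alpha>"
    proof eventually_elim
      case (elim \<alpha>)
      consider "\<alpha> < 0" | "0 < \<alpha>" "\<alpha> \<le> 1" | "1 < \<alpha>" using elim by linarith
      then show ?case
      proof cases
        case 2
        then have "{y. ennreal \<alpha> \<le> indicator K y} = K"
          by (auto simp: indicator_def split: if_splits)
        with 2 show ?thesis by simp
      next
        case 3
        then have "{y. ennreal \<alpha> \<le> indicator K y} = {}"
          by (auto simp: indicator_def not_le split: if_splits)
        with 3 show ?thesis using assms(1) e2ennreal_enn2ereal[of 0] by simp
      qed simp
    qed
  qed
  also have "\<dots> = ?c" by (simp add: nn_integral_cmult_indicator)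
  finally show ?thesis
    unfolding choquet_def using assms(2) by (simp add: enn2ereal_e2ennreal)
qed

section \<open>The Dellacherie envelope\<close>

locale common_capacity =
  fixes T :: "('y::metric_space \<Rightarrow> ennreal) \<Rightarrow> 'x::metric_space \<Rightarrow> ennreal"
  assumes compact_space: "compact (UNIV :: 'y set)"
    and capacity: "functional_capacity T"
    and common: "common (cap_fun T)"
begin

definition dom :: "'x \<Rightarrow> 'y measure set" where
  "dom x = {\<sigma> \<in> prob_measures. dominated_at \<sigma> (cap_fun T) x}"

text \<open>A real-valued form of \<open>dellacherie\<close>, which spares the arithmetic of
  infinite values. On C(Y) the supremum is finite, as \<open>dom x\<close> is non-empty and
  continuous functions are bounded.\<close>

definition env :: "('y \<Rightarrow> real) \<Rightarrow> 'x \<Rightarrow> real" where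
  "env g x = (SUP \<sigma>\<in>dom x. \<integral>y. g y \<partial>\<sigma>)"

lemma dom_nonempty: "dom x \<noteq> {}"
  using common by (auto simp: common_def dom_def)

lemma dom_integrable: "\<sigma> \<in> dom x \<Longrightarrow> g \<in> Cont \<Longrightarrow> integrable \<sigma> g"
  by (intro integrable_Cont[OF compact_space]) (simp_all add: dom_def)

lemma dom_prob_space: "\<sigma> \<in> dom x \<Longrightarrow> prob_space \<sigma>"
  by (simp add: dom_def prob_measures_def)

lemma dom_measure_space: "\<sigma> \<in> dom x \<Longrightarrow> measure \<sigma> (space \<sigma>) = 1"
  using prob_space.prob_space[OF dom_prob_space] by simp

lemma dom_integral_le:
  assumes "\<sigma> \<in> dom x" "g \<in> Cont" "\<And>y. g y \<le> c"
  shows "(\<integral>y. g y \<partial>\<sigma>) \<le> c"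
  using integral_mono[OF dom_integrable[OF assms(1,2)], of "\<lambda>_. c"] assms
    dom_integrable[OF assms(1), of "\<lambda>_. c"] dom_measure_space[OF assms(1)] by (simp add: Cont_iff)

section \<open>The envelope as a real-valued sublinear functional\<close>

lemma env_upper:
  assumes "\<sigma> \<in> dom x" "g \<in> Cont"
  shows "(\<integral>y. g y \<partial>\<sigma>) \<le> env g x"
  unfolding env_def
proof (rule cSUP_upper[OF assms(1)])
  obtain M where "\<And>y. \<bar>g y\<bar> \<le> M" by (metis Cont_bounded[OF compact_space assms(2)])
  then have "g y \<le> M" for y by (meson abs_le_D1)
  then show "bdd_above ((\<lambda>\<sigma>. \<integral>y. g y \<partial>\<sigma>) ` dom x)"
    using assms(2) by (intro bdd_aboveI2[of _ _ M] dom_integral_le)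
qed

lemma env_least: "(\<And>\<sigma>. \<sigma> \<in> dom x \<Longrightarrow> (\<integral>y. g y \<partial>\<sigma>) \<le> c) \<Longrightarrow> env g x \<le> c"
  unfolding env_def using dom_nonempty by (rule cSUP_least)

lemma dellacherie_eq_env:
  assumes "g \<in> Cont"
  shows "dellacherie T g x = ereal (env g x)"
  unfolding dellacherie_def dom_def[symmetric]
proof (rule antisym)
  show "(SUP \<sigma>\<in>dom x. ereal (\<integral>y. g y \<partial>\<sigma>)) \<le> ereal (env g x)"
    using assms by (intro SUP_least) (simp add: env_upper)
  \<comment> \<open>This covers a finite supremum; a member of \<open>dom x\<close> excludes the
    value minus infinity, and plus infinity is trivial.\<close>
  have "(SUP \<sigma>\<in>dom x. ereal (\<integral>y. g y \<partial>\<sigma>)) = ereal r \<Longrightarrow> env g x \<le> r" for r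
    by (intro env_least) (metis SUP_upper ereal_less_eq(3))
  moreover obtain \<sigma> where "\<sigma> \<in> dom x" using dom_nonempty by blast
  then have "ereal (\<integral>y. g y \<partial>\<sigma>) \<le> (SUP \<sigma>\<in>dom x. ereal (\<integral>y. g y \<partial>\<sigma>))"
    by (rule SUP_upper)
  ultimately show "ereal (env g x) \<le> (SUP \<sigma>\<in>dom x. ereal (\<integral>y. g y \<partial>\<sigma>))"
    by (cases "SUP \<sigma>\<in>dom x. ereal (\<integral>y. g y \<partial>\<sigma>)") auto
qed

lemma env_mono:
  assumes "g \<in> Cont" "h \<in> Cont" "\<And>y. g y \<le> h y"
  shows "env g x \<le> env h x"
  using assms
  by (intro env_least order_trans[OF integral_mono env_upper]) (auto intro: dom_integrable)

lemma env_add: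
  assumes "g \<in> Cont" "h \<in> Cont"
  shows "env (\<lambda>y. g y + h y) x \<le> env g x + env h x"
proof (rule env_least)
  fix \<sigma> assume "\<sigma> \<in> dom x"
  with assms show "(\<integral>y. g y + h y \<partial>\<sigma>) \<le> env g x + env h x"
    by (simp add: dom_integrable add_mono env_upper)
qed

lemma env_scale_le:
  assumes "g \<in> Cont" "0 \<le> t"
  shows "env (\<lambda>y. t * g y) x \<le> t * env g x"
  by (rule env_least) (use assms in \<open>auto intro!: mult_left_mono env_upper\<close>)

lemma env_const: "env (\<lambda>_. c) x = c"
proof (rule antisym)
  show "env (\<lambda>_. c) x \<le> c"
    by (rule env_least) (simp add: dom_measure_space)
  obtain \<sigma> where "\<sigma> \<in> dom x" using dom_nonempty by blast
  then show "c \<le> env (\<lambda>_. c) x"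
    using env_upper[of \<sigma> x "\<lambda>_. c"] by (simp add: Cont_iff dom_measure_space)
qed

lemma env_scale:
  assumes g: "g \<in> Cont" and t: "0 \<le> t"
  shows "env (\<lambda>y. t * g y) x = t * env g x"
proof (cases "t = 0")
  case False
  have "(\<lambda>y. t * g y) \<in> Cont" using g by (auto simp: Cont_iff intro: continuous_intros)
  from env_scale_le[OF this, of "1 / t" x] have "env g x \<le> 1 / t * env (\<lambda>y. t * g y) x"
    using False t by simp
  then show ?thesis
    using env_scale_le[OF g t, of x] False t by (simp add: field_simps)
qed (simp add: env_const)

lemma env_translate:
  assumes g: "g \<in> Cont"
  shows "env (\<lambda>y. g y + c) x = env g x + c"
proof (rule antisym)
  have C: "(\<lambda>_. c) \<in> Cont" "(\<lambda>_. - c) \<in> Cont" "(\<lambda>y. g y + c) \<in> Cont"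
    using g by (auto simp: Cont_iff intro: continuous_intros)
  show "env (\<lambda>y. g y + c) x \<le> env g x + c"
    using env_add[OF g C(1), of x] by (simp add: env_const)
  show "env g x + c \<le> env (\<lambda>y. g y + c) x"
    using env_add[OF C(3,2), of x] by (simp add: env_const)
qed

section \<open>The capacity and the envelope on compact sets\<close>

lemma cap_mono: "(\<And>y. f y \<le> g y) \<Longrightarrow> T f x \<le> T g x"
  using capacity by (auto simp: functional_capacity_def mono_def le_fun_def)

lemma cap_INF:
  assumes "\<And>n. g n \<in> USC_plus" "decseq g"
  shows "T (\<lambda>y. INF n. g n y) x = (INF n. T (g n) x)"
proof -
  have "T (\<lambda>y. INF n. g n y) = (\<lambda>x. INF n. T (g n) x)"
    using capacity assms unfolding functional_capacity_def by blast
  then show ?thesis by simp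
qed

lemma cap_USC: "g \<in> USC_plus \<Longrightarrow> cap_fun T g \<in> USC"
  using capacity by (simp add: functional_capacity_def cap_fun_def[abs_def])

lemma env_le_cap:
  assumes h: "h \<in> Cont" and K: "compact K" and le: "\<And>y. h y \<le> indicator K y"
  shows "ereal (env h x) \<le> cap_fun T (indicator K) x"
proof -
  have "ereal (\<integral>y. h y \<partial>\<sigma>) \<le> cap_fun T (indicator K) x" if \<sigma>: "\<sigma> \<in> dom x" for \<sigma>
  proof -
    interpret prob_space \<sigma> using dom_prob_space[OF \<sigma>] .
    have KS: "K \<in> sets \<sigma>"
      using \<sigma> K by (simp add: dom_def prob_measures_def compact_imp_closed)
    have "(\<integral>y. h y \<partial>\<sigma>) \<le> (\<integral>y. indicator K y \<partial>\<sigma>)"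
      using KS le by (intro integral_mono dom_integrable[OF \<sigma> h]) (auto simp: emeasure_eq_measure)
    also have "\<dots> = prob K" using KS by simp
    finally have "ereal (\<integral>y. h y \<partial>\<sigma>) \<le> enn2ereal (emeasure \<sigma> K)"
      by (simp add: emeasure_eq_measure enn2ereal_ennreal)
    also have "\<dots> \<le> cap_fun T (indicator K) x"
      using \<sigma> K by (simp add: dom_def dominated_at_def)
    finally show ?thesis .
  qed
  then show ?thesis
    unfolding dellacherie_eq_env[OF h, symmetric] dellacherie_def dom_def[symmetric]
    by (rule SUP_least)
qed

text \<open>The passage from continuous functions to compact sets: C runs through neighbourhoods
  decreasing to K, T(C) decreases to T(K), and each C leaves room for a continuous h on which
  integrals or operators can be tested.\<close>

lemma le_cap_compactI:
  assumes K: "compact K"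
    and le: "\<And>h C. h \<in> Cont \<Longrightarrow> compact C \<Longrightarrow> (\<And>y. indicator K y \<le> h y) \<Longrightarrow>
      (\<And>y. h y \<le> indicator C y) \<Longrightarrow> c \<le> cap_fun T (indicator C) x"
  shows "c \<le> cap_fun T (indicator K) x"
proof -
  obtain h :: "nat \<Rightarrow> 'y \<Rightarrow> real" and C where hC: "\<And>n. h n \<in> Cont" "\<And>n y. indicator K y \<le> h n y"
    "\<And>n y. h n y \<le> indicator (C n) y" "\<And>n. compact (C n)" "decseq C" "(\<Inter>n. C n) = K"
    using compact_Cont_approx[OF compact_space K] by blast
  have "indicator K = (\<lambda>y. INF n. indicator (C n) y :: ennreal)"
  proof
    fix y
    show "indicator K y = (INF n. indicator (C n) y :: ennreal)"
    proof (cases "y \<in> K")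
      case True
      then have "y \<in> C n" for n using hC(6) by auto
      then show ?thesis using True by simp
    next
      case False
      then obtain n where "y \<notin> C n" using hC(6) by auto
      then have "(INF n. indicator (C n) y :: ennreal) \<le> 0"
        by (intro INF_lower2[of n]) auto
      then show ?thesis using False by simp
    qed
  qed
  moreover have "decseq (\<lambda>n. indicator (C n) :: 'y \<Rightarrow> ennreal)"
  proof (intro decseq_SucI le_funI)
    fix n y
    show "indicator (C (Suc n)) y \<le> (indicator (C n) y :: ennreal)"
      using decseqD[OF hC(5), of n "Suc n"] by (auto simp: indicator_def)
  qed
  ultimately have "T (indicator K) x = (INF n. T (indicator (C n)) x)"
    using cap_INF[OF indicator_USC_plus[OF compact_imp_closed[OF hC(4)]], where x = x] by simp
  moreover have "c \<le> cap_fun T (indicator (C n)) x" for n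
    by (rule le[OF hC(1,4,2,3)])
  ultimately show ?thesis
    using le_enn2ereal_INF[of c "\<lambda>n. T (indicator (C n)) x"] by (simp add: cap_fun_def)
qed

lemma dellacherie_le_compact: "le_compact (kant_fun (dellacherie T)) (cap_fun T)"
  unfolding le_compact_def
proof (intro allI impI, rule le_cap_compactI)
  fix x and K C :: "'y set" and h :: "'y \<Rightarrow> real"
  assume h: "h \<in> Cont" "\<And>y. indicator K y \<le> h y" "\<And>y. h y \<le> indicator C y" and C: "compact C"
  have "kant_fun (dellacherie T) (indicator K) x \<le> dellacherie T h x"
    using h by (intro kant_fun_le) (simp_all add: enn2ereal_indicator_le)
  also have "\<dots> \<le> cap_fun T (indicator C) x"
    using env_le_cap[OF h(1) C h(3)] by (simp add: dellacherie_eq_env h)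
  finally show "kant_fun (dellacherie T) (indicator K) x \<le> cap_fun T (indicator C) x" .
qed

text \<open>The upper semicontinuous hull \<open>q\<close> of the envelope at \<open>x\<close> is again sublinear; a measure
  representing it at \<open>g\<close> is dominated by \<open>T\<close> at \<open>x\<close>, so that \<open>q g \<le> env g x\<close>.\<close>

lemma env_upper_semicontinuous:
  assumes g: "g \<in> Cont" and lt: "env g x < r"
  shows "eventually (\<lambda>z. env g z < r) (nhds x)"
proof -
  \<comment> \<open>\<open>q h\<close> below is the upper limit of \<open>env h\<close> at
    \<open>x\<close>. Neighbourhoods contain \<open>x\<close> itself, which makes \<open>q h\<close>
    at least \<open>env h x\<close>.\<close>
  define Q where "Q h = {c. eventually (\<lambda>z. env h z \<le> c) (nhds x)}" for h
  define q where "q h = Inf (Q h)" for h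
  have low: "env h x \<le> c" if "c \<in> Q h" for h c
    using that unfolding Q_def by (blast dest: eventually_nhds_x_imp_x)
  have bdd: "bdd_below (Q h)" for h
    using low by (intro bdd_belowI)
  have q_le: "q h \<le> c" if "eventually (\<lambda>z. env h z \<le> c) (nhds x)" for h c
    unfolding q_def by (rule cInf_lower[OF _ bdd]) (use that in \<open>simp add: Q_def\<close>)
  have q_less: "eventually (\<lambda>z. env h z \<le> c) (nhds x)" if h: "h \<in> Cont" and "q h < c" for h c
  proof -
    obtain M where M: "\<And>y. \<bar>h y\<bar> \<le> M" by (metis Cont_bounded[OF compact_space h])
    have "env h z \<le> M" for z
      using env_mono[OF h, of "\<lambda>_. M"] abs_le_D1[OF M] by (simp add: env_const Cont_iff)
    then have "M \<in> Q h" by (simp add: Q_def)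
    then obtain c' where "c' \<in> Q h" "c' < c"
      using cInf_lessD[of "Q h" c] \<open>q h < c\<close> by (auto simp: q_def)
    then show ?thesis by (auto simp: Q_def elim: eventually_mono)
  qed
  have q_ge: "env h x \<le> q h" if "h \<in> Cont" for h
  proof (rule dense_ge)
    fix c assume "q h < c"
    from q_less[OF that this] show "env h x \<le> c" by (intro low) (simp add: Q_def)
  qed
  have q_mono: "q h \<le> q k" if "h \<in> Cont" "k \<in> Cont" "\<And>y. h y \<le> k y" for h k
  proof (rule dense_ge)
    fix c assume "q k < c"
    from q_less[OF that(2) this] show "q h \<le> c"
      by (intro q_le, eventually_elim) (use env_mono[OF that] order_trans in blast)
  qed
  have q_add: "q (\<lambda>y. h y + k y) \<le> q h + q k" if h: "h \<in> Cont" and k: "k \<in> Cont" for h k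
  proof (rule field_le_epsilon)
    fix e :: real assume e: "0 < e"
    have "eventually (\<lambda>z. env h z \<le> q h + e / 2) (nhds x)" "eventually (\<lambda>z. env k z \<le> q k + e / 2) (nhds x)"
      using e by (auto intro: q_less h k)
    then show "q (\<lambda>y. h y + k y) \<le> q h + q k + e"
    proof (intro q_le, eventually_elim)
      case (elim z)
      then show ?case using env_add[OF h k, of z] by simp
    qed
  qed
  have q_const: "q (\<lambda>_. c) = c" for c
    using q_le[of "\<lambda>_. c" c] q_ge[of "\<lambda>_. c"] by (simp add: env_const Cont_iff)
  have q_scale_le: "q (\<lambda>y. t * h y) \<le> t * q h" if h: "h \<in> Cont" and t: "0 < t" for h t
  proof (rule dense_ge)
    fix c assume "t * q h < c"
    then have "q h < c / t" using t by (simp add: field_simps)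
    from q_less[OF h this] show "q (\<lambda>y. t * h y) \<le> c"
      by (intro q_le, eventually_elim) (use t in \<open>simp add: env_scale[OF h] field_simps\<close>)
  qed
  have q_scale: "q (\<lambda>y. t * h y) = t * q h" if h: "h \<in> Cont" and t: "0 \<le> t" for h t
  proof (cases "t = 0")
    case False
    have "(\<lambda>y. t * h y) \<in> Cont" using h by (auto simp: Cont_iff intro: continuous_intros)
    from q_scale_le[OF this, of "1 / t"] have "q h \<le> 1 / t * q (\<lambda>y. t * h y)"
      using False t by simp
    then show ?thesis
      using q_scale_le[OF h, of t] False t by (simp add: field_simps)
  qed (simp add: q_const)
  obtain \<sigma> where \<sigma>: "\<sigma> \<in> prob_measures" "(\<integral>y. g y \<partial>\<sigma>) = q g"
    "\<And>h. h \<in> Cont \<Longrightarrow> (\<integral>y. h y \<partial>\<sigma>) \<le> q h"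
    using sublinear_functional_representation[OF compact_space, of q g] q_mono q_add q_scale q_const g
    by blast
  have "dominated_at \<sigma> (cap_fun T) x"
    unfolding dominated_at_def
  proof (intro allI impI, rule le_cap_compactI)
    fix K C :: "'y set" and h :: "'y \<Rightarrow> real"
    assume K: "compact K" and C: "compact C"
      and h: "h \<in> Cont" "\<And>y. indicator K y \<le> h y" "\<And>y. h y \<le> indicator C y"
    have "enn2ereal (emeasure \<sigma> K) \<le> ereal (\<integral>y. h y \<partial>\<sigma>)"
      using nn_integral_le_Cont[OF compact_space \<sigma>(1) h(1), of "indicator K"] h(2)
      by (simp add: emeasure_compact_eq_nn_integral[OF \<sigma>(1) K] enn2ereal_indicator_le)
    also have "\<dots> \<le> ereal (q h)" using \<sigma>(3)[OF h(1)] by simp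
    also have "\<dots> \<le> cap_fun T (indicator C) x"
    proof (rule dense_ge)
      fix c assume c: "cap_fun T (indicator C) x < c"
      show "ereal (q h) \<le> c"
      proof (cases c)
        case (real c')
        \<comment> \<open>Here upper semicontinuity of z -> T^z(C) enters: near \<open>x\<close> all
          the values \<open>env h z\<close>, being below T^z(C), stay below c.\<close>
        have "open {z. cap_fun T (indicator C) z < c}"
          using cap_USC[OF indicator_USC_plus[OF compact_imp_closed[OF C]]]
          by (simp add: USC_def upper_semicontinuous_def)
        then have "eventually (\<lambda>z. cap_fun T (indicator C) z < c) (nhds x)"
          using c unfolding eventually_nhds by blast
        then have "eventually (\<lambda>z. env h z \<le> c') (nhds x)"
        proof eventually_elim
          case (elim z)
          with env_le_cap[OF h(1) C h(3), of z] have "ereal (env h z) \<le> c" by simp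
          then show ?case by (simp add: real)
        qed
        then show ?thesis using q_le real by simp
      qed (use c in auto)
    qed
    finally show "enn2ereal (emeasure \<sigma> K) \<le> cap_fun T (indicator C) x" .
  qed
  \<comment> \<open>The representing measure belongs to \<open>dom x\<close>, so the upper limit at
    \<open>x\<close> does not exceed the value at \<open>x\<close>.\<close>
  then have "q g \<le> env g x"
    using env_upper[OF _ g, of \<sigma> x] \<sigma>(1,2) by (simp add: dom_def)
  then obtain s where s: "q g < s" "s < r" using dense[of "q g" r] lt by auto
  from q_less[OF g s(1)] show ?thesis
    by eventually_elim (use s(2) in simp)
qed

section \<open>The envelope as a saturated Kantorovich operator\<close>

lemma dellacherie_USC:
  assumes g: "g \<in> Cont"
  shows "dellacherie T g \<in> USC"
  unfolding USC_def upper_semicontinuous_def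
proof (intro CollectI conjI allI)
  fix c
  show "open {x. dellacherie T g x < c}"
  proof (cases c)
    case (real r)
    have "\<exists>S. open S \<and> x \<in> S \<and> S \<subseteq> {x. env g x < r}" if "env g x < r" for x
      using env_upper_semicontinuous[OF g that] unfolding eventually_nhds by blast
    then have "open {x. env g x < r}"
      by (subst open_subopen) simp
    then show ?thesis by (simp add: real dellacherie_eq_env[OF g])
  qed (simp_all add: dellacherie_eq_env[OF g])
  obtain M where M: "\<And>y. \<bar>g y\<bar> \<le> M" by (metis Cont_bounded[OF compact_space g])
  have "env g z \<le> M" for z
    using env_mono[OF g, of "\<lambda>_. M"] abs_le_D1[OF M] by (simp add: env_const Cont_iff)
  then show "\<exists>M. \<forall>x. dellacherie T g x \<le> ereal M"
    by (auto simp: dellacherie_eq_env[OF g])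
  show "\<exists>x. dellacherie T g x \<noteq> - \<infinity>"
    by (simp add: dellacherie_eq_env[OF g])
qed

lemma dellacherie_backward_Kantorovich: "backward_Kantorovich (dellacherie T)"
  unfolding backward_Kantorovich_def
proof (intro conjI ballI allI impI)
  fix g :: "'y \<Rightarrow> real" assume g: "g \<in> Cont"
  then show "dellacherie T g \<in> USC" by (rule dellacherie_USC)
  fix c x
  have "(\<lambda>y. g y + c) \<in> Cont" using g by (auto simp: Cont_iff intro: continuous_intros)
  then show "dellacherie T (\<lambda>y. g y + c) x = dellacherie T g x + ereal c"
    by (simp add: dellacherie_eq_env g env_translate)
next
  fix g h :: "'y \<Rightarrow> real" assume gh: "g \<in> Cont" "h \<in> Cont"
  then show "dellacherie T g \<le> dellacherie T h" if "g \<le> h"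
    using that by (auto simp: le_fun_def dellacherie_eq_env intro: env_mono)
  fix t :: real and x assume t: "t \<in> {0..1}"
  have C: "(\<lambda>y. t * g y) \<in> Cont" "(\<lambda>y. (1 - t) * h y) \<in> Cont"
    "(\<lambda>y. t * g y + (1 - t) * h y) \<in> Cont"
    using gh by (auto simp: Cont_iff intro!: continuous_intros)
  show "dellacherie T (\<lambda>y. t * g y + (1 - t) * h y) x
      \<le> ereal t * dellacherie T g x + ereal (1 - t) * dellacherie T h x"
    using env_add[OF C(1,2), of x] t by (simp add: dellacherie_eq_env gh C env_scale)
next
  fix g :: "nat \<Rightarrow> 'y \<Rightarrow> real" and h x
  assume "(\<forall>n. g n \<in> Cont) \<and> h \<in> Cont \<and> uniform_limit UNIV g h sequentially"
  then have g: "\<And>n. g n \<in> Cont" and h: "h \<in> Cont" and lim: "uniform_limit UNIV g h sequentially"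
    by auto
  show "dellacherie T h x \<le> liminf (\<lambda>n. dellacherie T (g n) x)"
    unfolding le_Liminf_iff
  proof (intro allI impI)
    fix c assume c: "c < dellacherie T h x"
    show "eventually (\<lambda>n. c < dellacherie T (g n) x) sequentially"
    proof (cases c)
      case (real r)
      \<comment> \<open>Half the gap: uniform closeness within e moves the envelope by at most e,
        which leaves a margin of e above r.\<close>
      define e where "e = (env h x - r) / 2"
      have e: "0 < e" using c real by (simp add: e_def dellacherie_eq_env[OF h])
      have e_eq: "env h x = r + 2 * e" by (simp add: e_def field_simps)
      from uniform_limitD[OF lim e] show ?thesis
      proof eventually_elim
        case (elim n)
        have "h y \<le> g n y + e" for y
          using elim[rule_format, of y] by (simp add: dist_real_def abs_less_iff)
        then have "env h x \<le> env (\<lambda>y. g n y + e) x"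
          using h g[of n] by (intro env_mono) (auto simp: Cont_iff intro!: continuous_intros)
        also have "\<dots> = env (g n) x + e" by (rule env_translate[OF g])
        finally show ?case
          using e real e_eq by (simp add: g dellacherie_eq_env)
      qed
    qed (use c in \<open>auto simp: dellacherie_eq_env g\<close>)
  qed
qed

lemma dellacherie_pos_homogenous: "pos_homogenous_kant (dellacherie T)"
  unfolding pos_homogenous_kant_def
proof (intro ballI allI impI)
  fix g :: "'y \<Rightarrow> real" and t :: real and x assume g: "g \<in> Cont" and t: "0 \<le> t"
  have "(\<lambda>y. t * g y) \<in> Cont" using g by (auto simp: Cont_iff intro: continuous_intros)
  then show "dellacherie T (\<lambda>y. t * g y) x = ereal t * dellacherie T g x"
    using g t by (simp add: dellacherie_eq_env env_scale)
qed

lemma dom_kant_fun_dellacherie: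
  assumes \<sigma>: "\<sigma> \<in> dom x"
  shows "enn2ereal (\<integral>\<^sup>+y. f y \<partial>\<sigma>) \<le> kant_fun (dellacherie T) f x"
  using \<sigma> by (intro nn_integral_le_kant_fun[OF compact_space])
    (auto simp: dom_def dellacherie_eq_env env_upper)

text \<open>A measure dominated by the envelope on compact sets is dominated by \<open>T\<close> as
  well. It therefore takes part in the supremum defining the envelope, which bounds its
  integrals.\<close>

lemma dellacherie_saturated: "saturated (kant_fun (dellacherie T))"
  unfolding saturated_def
proof (intro allI ballI iffI)
  fix x \<sigma> f
  assume \<sigma>: "\<sigma> \<in> prob_measures" "dominated_at \<sigma> (kant_fun (dellacherie T)) x"
  then have "\<sigma> \<in> dom x"
    using dellacherie_le_compact unfolding dom_def dominated_at_def le_compact_def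
    by (blast intro: order_trans)
  then show "enn2ereal (\<integral>\<^sup>+y. f y \<partial>\<sigma>) \<le> kant_fun (dellacherie T) f x"
    by (rule dom_kant_fun_dellacherie)
next
  fix x and \<sigma> :: "'y measure"
  assume \<sigma>: "\<sigma> \<in> prob_measures"
    and le: "\<forall>f\<in>USC_plus. enn2ereal (\<integral>\<^sup>+y. f y \<partial>\<sigma>) \<le> kant_fun (dellacherie T) f x"
  show "dominated_at \<sigma> (kant_fun (dellacherie T)) x"
    unfolding dominated_at_def
    using le indicator_USC_plus[OF compact_imp_closed]
    by (auto simp: emeasure_compact_eq_nn_integral[OF \<sigma>])
qed

section \<open>Comparison of the envelope with capacities and Kantorovich operators\<close>

lemma dellacherie_le_saturated:
  assumes \<Phi>: "saturated \<Phi>"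
    and le: "\<And>K. compact K \<Longrightarrow> cap_fun T (indicator K) x \<le> \<Phi> (indicator K) x"
    and h: "h \<in> Cont_plus"
  shows "dellacherie T h x \<le> \<Phi> (\<lambda>y. ennreal (h y)) x"
  unfolding dellacherie_def dom_def[symmetric]
proof (rule SUP_least)
  fix \<sigma> assume "\<sigma> \<in> dom x"
  \<comment> \<open>Domination passes from \<open>T\<close> to \<open>\<Phi>\<close>, where
    saturation acts. The choice \<open>\<Phi> = cap_fun T\<close> serves (3) and (4), and
    \<open>\<Phi> = kant_fun S\<close> serves (5).\<close>
  then have "\<sigma> \<in> prob_measures" "dominated_at \<sigma> \<Phi> x"
    using le by (auto simp: dom_def dominated_at_def intro: order_trans)
  then show "ereal (\<integral>y. h y \<partial>\<sigma>) \<le> \<Phi> (\<lambda>y. ennreal (h y)) x"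
    by (intro saturated_integral_le[OF compact_space \<Phi>] h)
qed

text \<open>The bound on continuous functions extends to \<open>f\<close> through continuous
  majorants decreasing to it, along which \<open>T\<close> is continuous.\<close>

lemma dellacherie_le_USC_plus_cap:
  assumes "saturated (cap_fun T)"
  shows "le_USC_plus (kant_fun (dellacherie T)) (cap_fun T)"
  unfolding le_USC_plus_def
proof (intro ballI allI)
  fix f :: "'y \<Rightarrow> ennreal" and x assume f: "f \<in> USC_plus"
  obtain h where h: "\<And>n. h n \<in> Cont_plus" "\<And>n y. f y \<le> ennreal (h n y)"
    "\<And>y. decseq (\<lambda>n. h n y)" "\<And>y. (INF n. ennreal (h n y)) = f y"
    using USC_plus_Cont_approx[OF f] by blast
  have "kant_fun (dellacherie T) f x \<le> enn2ereal (T (\<lambda>y. ennreal (h n y)) x)" for n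
  proof -
    have "enn2ereal (f y) \<le> ereal (h n y)" for y
      using h(1)[of n] h(2)[of y n] by (metis Cont_plus_iff enn2ereal_ennreal less_eq_ennreal.rep_eq)
    then have "kant_fun (dellacherie T) f x \<le> dellacherie T (h n) x"
      using h(1) by (intro kant_fun_le) (auto simp: Cont_plus_def)
    also have "\<dots> \<le> cap_fun T (\<lambda>y. ennreal (h n y)) x"
      by (intro dellacherie_le_saturated assms h order_refl)
    finally show ?thesis by (simp add: cap_fun_def)
  qed
  then have "kant_fun (dellacherie T) f x \<le> enn2ereal (INF n. T (\<lambda>y. ennreal (h n y)) x)"
    by (rule le_enn2ereal_INF)
  also have "(INF n. T (\<lambda>y. ennreal (h n y)) x) = T f x"
  proof -
    have "decseq (\<lambda>n y. ennreal (h n y))"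
      by (intro decseq_SucI le_funI ennreal_leI decseqD[OF h(3)]) simp
    then show ?thesis
      using cap_INF[of "\<lambda>n y. ennreal (h n y)" x] Cont_plus_USC_plus[OF compact_space h(1)]
      by (simp add: h(4))
  qed
  finally show "kant_fun (dellacherie T) f x \<le> cap_fun T f x"
    by (simp add: cap_fun_def)
qed

text \<open>Comparison on compact sets alone forces comparison on C(Y), since the measure supporting
  S at \<open>g\<close> and \<open>x\<close> is itself a member of \<open>dom x\<close>.\<close>

lemma Kantorovich_le_dellacherie:
  assumes S: "backward_Kantorovich S" "pos_homogenous_kant S"
    and le: "\<And>K. compact K \<Longrightarrow> kant_fun S (indicator K) x \<le> cap_fun T (indicator K) x"
    and g: "g \<in> Cont"
  shows "S g x \<le> dellacherie T g x"
proof -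
  obtain \<sigma> where \<sigma>: "\<sigma> \<in> prob_measures" "ereal (\<integral>y. g y \<partial>\<sigma>) = S g x"
    "\<And>h. h \<in> Cont \<Longrightarrow> ereal (\<integral>y. h y \<partial>\<sigma>) \<le> S h x"
    using backward_Kantorovich_representation[OF compact_space S g, of x] by blast
  have "dominated_at \<sigma> (kant_fun S) x"
    by (rule dominated_at_kant_fun[OF compact_space \<sigma>(1)]) (rule \<sigma>(3))
  then have "\<sigma> \<in> dom x"
    using \<sigma>(1) le by (auto simp: dom_def dominated_at_def intro: order_trans)
  then show ?thesis
    unfolding \<sigma>(2)[symmetric] by (simp add: dellacherie_eq_env[OF g] env_upper[OF _ g])
qed

text \<open>Homogeneity of \<open>T\<close> concerns non-negative functions only. It passes to S on
  non-negative continuous functions, where S and \<open>T\<close> agree, and to all of C(Y) by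
  adding a constant M and removing it again with S(g + M) = S g + M.\<close>

lemma pos_homogenous_Kantorovich_capacityE:
  assumes "Kantorovich_capacity T" "pos_homogenous_cap T"
  obtains S where "backward_Kantorovich S" "pos_homogenous_kant S"
    "\<And>f x. f \<in> USC_plus \<Longrightarrow> cap_fun T f x = kant_fun S f x"
proof -
  obtain S where S: "backward_Kantorovich S"
    and TS: "\<And>f x. f \<in> USC_plus \<Longrightarrow> cap_fun T f x = kant_fun S f x"
    using assms(1) unfolding Kantorovich_capacity_def by blast
  have S_cap: "S h x = enn2ereal (T (\<lambda>y. ennreal (h y)) x)" if "h \<in> Cont_plus" for h x
    using TS[OF Cont_plus_USC_plus[OF compact_space that], of x] kant_fun_Cont_plus[OF S that, of x]
    by (simp add: cap_fun_def)
  have homog: "S (\<lambda>y. t * h y) x = ereal t * S h x" if h: "h \<in> Cont_plus" and t: "0 \<le> t" for h t x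
  proof -
    have "(\<lambda>y. t * h y) \<in> Cont_plus"
      using h t by (auto simp: Cont_plus_iff intro!: continuous_intros)
    moreover have "(\<lambda>y. ennreal (t * h y)) = (\<lambda>y. ennreal t * ennreal (h y))"
      using h t by (auto simp: Cont_plus_iff ennreal_mult)
    ultimately show ?thesis
      using assms(2) t
      by (simp add: S_cap h pos_homogenous_cap_def times_ennreal.rep_eq enn2ereal_ennreal)
  qed
  have "pos_homogenous_kant S"
    unfolding pos_homogenous_kant_def
  proof (intro ballI allI impI)
    fix g :: "'y \<Rightarrow> real" and t :: real and x assume g: "g \<in> Cont" and t: "0 \<le> t"
    obtain M where M: "\<And>y. \<bar>g y\<bar> \<le> M" by (metis Cont_bounded[OF compact_space g])
    have gM: "0 \<le> g y + M" for y using M[of y] by (simp add: abs_le_iff)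
    then have h: "(\<lambda>y. g y + M) \<in> Cont_plus"
      using g by (auto simp: Cont_plus_iff Cont_iff intro!: continuous_intros)
    have tg: "(\<lambda>y. t * g y) \<in> Cont" using g by (auto simp: Cont_iff intro: continuous_intros)
    \<comment> \<open>The shifted value is finite, being non-negative and bounded above, so M can be
      subtracted in ereal.\<close>
    have "0 \<le> S (\<lambda>y. g y + M) x" by (simp add: S_cap[OF h])
    moreover obtain B where "S (\<lambda>y. g y + M) x \<le> ereal B"
      using backward_KantorovichD(1)[OF S, of "\<lambda>y. g y + M"] h by (auto simp: USC_def Cont_plus_def)
    ultimately obtain a where a: "S (\<lambda>y. g y + M) x = ereal a"
      by (cases "S (\<lambda>y. g y + M) x") auto
    have Sg: "S g x = ereal (a - M)"
      using backward_KantorovichD(3)[OF S g, of M x] a by (cases "S g x") auto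
    have "S (\<lambda>y. t * g y) x + ereal (t * M) = S (\<lambda>y. t * (g y + M)) x"
      using backward_KantorovichD(3)[OF S tg, of "t * M" x] by (simp add: algebra_simps)
    also have "\<dots> = ereal (t * a)" using homog[OF h t, of x] a by simp
    finally show "S (\<lambda>y. t * g y) x = ereal t * S g x"
      unfolding Sg by (cases "S (\<lambda>y. t * g y) x") (auto simp: algebra_simps)
  qed
  with S TS show thesis by (intro that)
qed

lemma cap_le_dellacherie:
  assumes T: "Kantorovich_capacity T" "pos_homogenous_cap T" and g: "g \<in> Cont_plus"
  shows "cap_fun T (\<lambda>y. ennreal (g y)) x \<le> dellacherie T g x"
proof -
  obtain S where S: "backward_Kantorovich S" "pos_homogenous_kant S"
    and TS: "\<And>f x. f \<in> USC_plus \<Longrightarrow> cap_fun T f x = kant_fun S f x"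
    using pos_homogenous_Kantorovich_capacityE[OF T] by blast
  have "cap_fun T (\<lambda>y. ennreal (g y)) x = S g x"
    using TS[OF Cont_plus_USC_plus[OF compact_space g]] kant_fun_Cont_plus[OF S(1) g] by simp
  also have "\<dots> \<le> dellacherie T g x"
  proof (rule Kantorovich_le_dellacherie[OF S])
    show "kant_fun S (indicator K) x \<le> cap_fun T (indicator K) x" if "compact K" for K
      using TS[OF indicator_USC_plus[OF compact_imp_closed[OF that]], of x] by simp
  qed (use g in \<open>simp add: Cont_plus_def\<close>)
  finally show ?thesis .
qed

lemma cap_le_USC_plus_dellacherie:
  assumes "Kantorovich_capacity T" "pos_homogenous_cap T"
  shows "le_USC_plus (cap_fun T) (kant_fun (dellacherie T))"
  unfolding le_USC_plus_def kant_fun_def usc_ext_def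
proof (intro ballI allI INF_greatest)
  fix f :: "'y \<Rightarrow> ennreal" and x h
  assume "h \<in> {h \<in> Cont. \<forall>y. enn2ereal (f y) \<le> ereal (h y)}"
  then have h: "h \<in> Cont" and le: "\<And>y. enn2ereal (f y) \<le> ereal (h y)" by auto
  have "0 \<le> h y" for y using order_trans[OF enn2ereal_nonneg le] by simp
  then have hp: "h \<in> Cont_plus" using h by (simp add: Cont_plus_def)
  have "cap_fun T f x \<le> cap_fun T (\<lambda>y. ennreal (h y)) x"
    unfolding cap_fun_def less_eq_ennreal.rep_eq[symmetric] by (intro cap_mono le_ennreal_if le)
  also have "\<dots> \<le> dellacherie T h x" by (rule cap_le_dellacherie[OF assms hp])
  finally show "cap_fun T f x \<le> dellacherie T h x" .
qed

text \<open>The supremum is attained, because the envelope itself is an admissible S. For the upper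
  bound the Choquet order is evaluated on indicators of compact sets; this requires both operators
  to vanish on the empty set.\<close>

lemma dellacherie_eq_SUP:
  assumes "pos_homogenous_cap T" and g: "g \<in> Cont"
  shows "dellacherie T g x =
    (SUP S\<in>{S. backward_Kantorovich S \<and> pos_homogenous_kant S \<and>
      le_USC_plus (choquet (kant_fun S)) (choquet (cap_fun T))}. S g x)"
    (is "_ = (SUP S\<in>?A. S g x)")
proof (rule antisym)
  have "dellacherie T \<in> ?A"
    using dellacherie_backward_Kantorovich dellacherie_pos_homogenous
      choquet_mono[OF compact_space dellacherie_le_compact] by simp
  then show "dellacherie T g x \<le> (SUP S\<in>?A. S g x)" by (rule SUP_upper)
  show "(SUP S\<in>?A. S g x) \<le> dellacherie T g x"
  proof (rule SUP_least)
    fix S assume "S \<in> ?A"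
    then have S: "backward_Kantorovich S" "pos_homogenous_kant S"
      and le: "le_USC_plus (choquet (kant_fun S)) (choquet (cap_fun T))" by auto
    have empty: "indicator {} = (\<lambda>_::'y. 0::ennreal)" by (simp add: fun_eq_iff)
    \<comment> \<open>Homogeneity with factor 0 yields T(0) = 0.\<close>
    have "T (\<lambda>y. ennreal 0 * indicator {} y) x = ennreal 0 * T (indicator {}) x"
      using assms(1) unfolding pos_homogenous_cap_def by blast
    then have T0: "cap_fun T (indicator {}) x = 0"
      by (simp add: cap_fun_def empty zero_ennreal.rep_eq)
    have S0: "kant_fun S (indicator {}) x = 0"
      using kant_fun_Cont_plus[OF S(1), of "\<lambda>_. 0" x] pos_homogenous_kant_const[OF S, of 0 x]
      by (simp add: Cont_plus_iff empty zero_ereal_def)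
    have S_nonneg: "0 \<le> kant_fun S f x" for f
      unfolding kant_fun_def usc_ext_def
    proof (rule INF_greatest)
      fix h assume "h \<in> {h \<in> Cont. \<forall>y. enn2ereal (f y) \<le> ereal (h y)}"
      then have h: "h \<in> Cont" "\<And>y. enn2ereal (f y) \<le> ereal (h y)" by auto
      have "0 \<le> h y" for y using order_trans[OF enn2ereal_nonneg h(2)] by simp
      then have "S (\<lambda>_. 0) x \<le> S h x"
        using h(1) by (intro backward_KantorovichD(2)[OF S(1)]) (auto simp: Cont_iff)
      then show "0 \<le> S h x" by (simp add: pos_homogenous_kant_const[OF S] zero_ereal_def)
    qed
    show "S g x \<le> dellacherie T g x"
    proof (rule Kantorovich_le_dellacherie[OF S _ g])
      fix K :: "'y set" assume "compact K"
      then have "choquet (kant_fun S) (indicator K) x \<le> choquet (cap_fun T) (indicator K) x"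
        using le indicator_USC_plus compact_imp_closed unfolding le_USC_plus_def by blast
      then show "kant_fun S (indicator K) x \<le> cap_fun T (indicator K) x"
        by (simp add: choquet_indicator S0 T0 S_nonneg cap_fun_def[of T "indicator K"])
    qed
  qed
qed

text \<open>Every measure in \<open>dom x\<close> is dominated by the larger S, whose saturation
  bounds its integrals of non-negative continuous functions. Every continuous majorant of
  \<open>f\<close> is non-negative, so the bound reaches the infimum defining the extension of
  S.\<close>

lemma dellacherie_minimal:
  assumes S: "backward_Kantorovich S" "saturated (kant_fun S)"
    and le: "le_USC_plus (cap_fun T) (kant_fun S)"
  shows "le_USC_plus (kant_fun (dellacherie T)) (kant_fun S)"
  unfolding le_USC_plus_def
proof (intro ballI allI)
  fix f :: "'y \<Rightarrow> ennreal" and x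
  show "kant_fun (dellacherie T) f x \<le> kant_fun S f x"
    unfolding kant_fun_def[of S] usc_ext_def
  proof (rule INF_greatest)
    fix h assume "h \<in> {h \<in> Cont. \<forall>y. enn2ereal (f y) \<le> ereal (h y)}"
    then have h: "h \<in> Cont" "\<And>y. enn2ereal (f y) \<le> ereal (h y)" by auto
    have "0 \<le> h y" for y using order_trans[OF enn2ereal_nonneg h(2)] by simp
    then have hp: "h \<in> Cont_plus" using h by (simp add: Cont_plus_def)
    have "kant_fun (dellacherie T) f x \<le> dellacherie T h x" by (rule kant_fun_le[OF h])
    also have "\<dots> \<le> kant_fun S (\<lambda>y. ennreal (h y)) x"
      using le indicator_USC_plus compact_imp_closed
      by (intro dellacherie_le_saturated S(2) hp) (auto simp: le_USC_plus_def)
    also have "\<dots> = S h x" by (rule kant_fun_Cont_plus[OF S(1) hp])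
    finally show "kant_fun (dellacherie T) f x \<le> S h x" .
  qed
qed

end

text \<open>That the envelope lies above \<open>T\<close> is derived from the bound in (2), so this
  half of (5) carries the hypotheses of (2).\<close>

theorem theorem6p10:
  fixes T :: "('y::metric_space \<Rightarrow> ennreal) \<Rightarrow> 'x::metric_space \<Rightarrow> ennreal"
  assumes "compact (UNIV :: 'x set)" and "compact (UNIV :: 'y set)"
    and "functional_capacity T" and "common (cap_fun T)"
  shows
    "(backward_Kantorovich (dellacherie T) \<and> pos_homogenous_kant (dellacherie T) \<and>
        saturated (kant_fun (dellacherie T)) \<and>
        le_compact (kant_fun (dellacherie T)) (cap_fun T)) \<and>
     (Kantorovich_capacity T \<and> pos_homogenous_cap T \<longrightarrow>
        (\<forall>g\<in>Cont_plus. \<forall>x. cap_fun T (\<lambda>y. ennreal (g y)) x \<le> dellacherie T g x) \<and>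
        (\<forall>g\<in>Cont. \<forall>x. dellacherie T g x =
           (SUP S\<in>{S. backward_Kantorovich S \<and> pos_homogenous_kant S \<and>
                      le_USC_plus (choquet (kant_fun S)) (choquet (cap_fun T))}. S g x))) \<and>
     (saturated (cap_fun T) \<longrightarrow> le_USC_plus (kant_fun (dellacherie T)) (cap_fun T)) \<and>
     (saturated (cap_fun T) \<and> Kantorovich_capacity T \<and> pos_homogenous_cap T \<longrightarrow>
        (\<forall>g\<in>Cont_plus. \<forall>x. cap_fun T (\<lambda>y. ennreal (g y)) x = dellacherie T g x)) \<and>
     ((\<forall>S. backward_Kantorovich S \<and> pos_homogenous_kant S \<and> saturated (kant_fun S) \<and>
           le_USC_plus (cap_fun T) (kant_fun S) \<longrightarrow>
             le_USC_plus (kant_fun (dellacherie T)) (kant_fun S)) \<and>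
      (Kantorovich_capacity T \<and> pos_homogenous_cap T \<longrightarrow>
           le_USC_plus (cap_fun T) (kant_fun (dellacherie T))))"
proof -
  interpret common_capacity T
    using assms(2-4) by unfold_locales
  show ?thesis
  proof (intro conjI impI ballI allI; (elim conjE)?)
    fix g :: "'y \<Rightarrow> real" and x
    assume "saturated (cap_fun T)" "Kantorovich_capacity T" "pos_homogenous_cap T" "g \<in> Cont_plus"
    then show "cap_fun T (\<lambda>y. ennreal (g y)) x = dellacherie T g x"
      by (intro antisym cap_le_dellacherie dellacherie_le_saturated) auto
  qed (simp_all add: dellacherie_backward_Kantorovich dellacherie_pos_homogenous dellacherie_saturated
      dellacherie_le_compact cap_le_dellacherie dellacherie_eq_SUP dellacherie_le_USC_plus_cap
      dellacherie_minimal cap_le_USC_plus_dellacherie)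
qed

end
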